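(* Put $\rho=\prod_{k=1}^\infty(1-\alpha^k)^{t_k}$. Then the sequence $(p_n,\,n\ge0)$ with $$p_n=\rho\,\alpha^n f_n=f_n\prod_{k=1}^\infty(1-\alpha^k)^{t_k+n r_k}$$ (where the second equality is part of the assertion) is an infinitely divisible probability distribution on the non-negative integers.
   Context: An unlabeled tree (resp. forest) on $n$ vertices is an isomorphism class of trees (resp. acyclic simple graphs) with $n$ vertices. $t_n$ denotes the number of unlabeled (unrooted) trees on $n$ vertices, $r_n$ the number of unlabeled rooted trees on $n$ vertices, and $f_n$ the number of unlabeled forests (of unrooted trees) on $n$ vertices, with the convention $f_0=1$. Otter's constants $\alpha,\beta\in(0,\infty)$ are the constants for which $\lim_{n\to\infty}\alpha^n n^{5/2}t_n=\beta$ (this limit relation is Otter's theorem); $\alpha\approx0.338$, $\beta\approx 0.534$. It is known that $\alpha$ satisfies $\alpha=\prod_{k=1}^\infty(1-\alpha^k)^{r_k}$. A probability distribution $\pi$ is infinitely divisible if, for every $n\ge1$, there are independent and identically distributed random variables $X_1,\ldots,X_n$ such that $X_1+\cdots+X_n$ has distribution $\pi$. *)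

theory Defs
  imports "HOL-Probability.Probability"
begin

section \<open>Finite simple graphs, forests and trees\<close>

text \<open>
  A simple graph is given by its vertex set and its adjacency relation. The cycle-freeness and
  tree predicates of the library's digraph theory are not usable here: in a symmetric digraph each
  edge already yields a directed cycle of length two.
\<close>

definition simple_graph :: "'a set \<Rightarrow> ('a \<times> 'a) set \<Rightarrow> bool" where
  "simple_graph V E \<longleftrightarrow> finite V \<and> E \<subseteq> V \<times> V \<and> sym E \<and> irrefl E"

definition is_cycle :: "('a \<times> 'a) set \<Rightarrow> 'a list \<Rightarrow> bool" where
  "is_cycle E xs \<longleftrightarrow> 3 \<le> length xs \<and> distinct xs \<and>
     (\<forall>i<length xs. (xs ! i, xs ! (Suc i mod length xs)) \<in> E)"

definition forest :: "'a set \<Rightarrow> ('a \<times> 'a) set \<Rightarrow> bool" where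
  "forest V E \<longleftrightarrow> simple_graph V E \<and> \<not> (\<exists>xs. is_cycle E xs)"

definition tree :: "'a set \<Rightarrow> ('a \<times> 'a) set \<Rightarrow> bool" where
  "tree V E \<longleftrightarrow> forest V E \<and> V \<noteq> {} \<and> (\<forall>u\<in>V. \<forall>v\<in>V. (u, v) \<in> E\<^sup>*)"

definition graph_iso :: "('a \<Rightarrow> 'b) \<Rightarrow> 'a set \<Rightarrow> ('a \<times> 'a) set \<Rightarrow> 'b set \<Rightarrow> ('b \<times> 'b) set \<Rightarrow> bool" where
  "graph_iso \<phi> V E W F \<longleftrightarrow> bij_betw \<phi> V W \<and> map_prod \<phi> \<phi> ` E = F"


section \<open>Counting isomorphism classes\<close>

text \<open>
  Every graph on \<open>n\<close> vertices is isomorphic to one with vertex set \<open>{..<n}\<close>, so the isomorphism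
  classes are counted among graphs on this vertex set. A rooted tree is a pair of an edge relation
  and a root, and isomorphisms of rooted trees preserve the root.
\<close>

definition iso_rel :: "nat \<Rightarrow> ((nat \<times> nat) set \<times> (nat \<times> nat) set) set" where
  "iso_rel n = {(E, F). \<exists>\<phi>. graph_iso \<phi> {..<n} E {..<n} F}"

definition rooted_iso_rel :: "nat \<Rightarrow> (((nat \<times> nat) set \<times> nat) \<times> ((nat \<times> nat) set \<times> nat)) set" where
  "rooted_iso_rel n = {((E, x), (F, y)). \<exists>\<phi>. graph_iso \<phi> {..<n} E {..<n} F \<and> \<phi> x = y}"

definition num_trees :: "nat \<Rightarrow> nat" where
  "num_trees n = card ({E. tree {..<n} E} // iso_rel n)"

definition num_rooted_trees :: "nat \<Rightarrow> nat" where
  "num_rooted_trees n = card ({(E, x). tree {..<n} E \<and> x < n} // rooted_iso_rel n)"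

definition num_forests :: "nat \<Rightarrow> nat" where
  "num_forests n = card ({E. forest {..<n} E} // iso_rel n)"

lemma num_forests_0: "num_forests 0 = 1"
proof -
  have "{E. forest {..<0::nat} E} = {{}}"
    by (auto simp: forest_def simple_graph_def is_cycle_def sym_def irrefl_def intro!: exI[of _ 0])
  then show ?thesis
    by (simp add: num_forests_def quotient_def)
qed


section \<open>Infinite divisibility\<close>

text \<open>
  Taking \<open>nat \<Rightarrow> real\<close> as the type of the sample space is no restriction: random variables
  \<open>X\<^sub>1, \<dots>, X\<^sub>n\<close> on any probability space can be replaced by the coordinate functions under their
  joint distribution.
\<close>

definition infinitely_divisible :: "real measure \<Rightarrow> bool" where
  "infinitely_divisible \<pi> \<longleftrightarrow> prob_space \<pi> \<and> sets \<pi> = sets borel \<and>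
     (\<forall>n\<ge>1. \<exists>(M :: (nat \<Rightarrow> real) measure) (X :: nat \<Rightarrow> (nat \<Rightarrow> real) \<Rightarrow> real).
        prob_space M \<and>
        prob_space.indep_vars M (\<lambda>_. borel) X {1..n} \<and>
        (\<forall>i\<in>{1..n}. \<forall>j\<in>{1..n}. distr M borel (X i) = distr M borel (X j)) \<and>
        distr M borel (\<lambda>\<omega>. \<Sum>i=1..n. X i \<omega>) = \<pi>)"

end

theory Submission
  imports Defs "HOL-Real_Asymp.Real_Asymp"
begin

text \<open>
  Cutting a forest into its trees shows that an unlabelled forest is a multiset of unlabelled trees,
  so \<open>F(x) = \<Sum>n. f\<^sub>n x\<^sup>n = \<Prod>k. (1 - x\<^sup>k) powr (- t\<^sub>k)\<close>. At \<open>x = \<alpha>\<close> this says that the numbers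
  \<open>\<rho> \<alpha>\<^sup>n f\<^sub>n\<close> sum to one. The logarithm of \<open>F\<close> has nonnegative coefficients, because each factor
  contributes \<open>- log (1 - x\<^sup>k) = \<Sum>j. x\<^sup>j\<^sup>k / j\<close>. Therefore \<open>F(\<alpha>x) / F(\<alpha>)\<close> is the generating function of a
  compound Poisson distribution, and its \<open>m\<close>-th root is again the generating function of a
  distribution: this is infinite divisibility. The logarithmic derivative enters in the form of the
  recurrence \<open>n f\<^sub>n = \<Sum>k\<le>n. A\<^sub>k f\<^sub>n\<^sub>-\<^sub>k\<close> with \<open>A\<^sub>k\<close> the sum of \<open>d t\<^sub>d\<close> over the divisors \<open>d\<close> of \<open>k\<close>
  (\<open>num_msets_recurrence\<close>), and a distribution that satisfies such a recurrence with nonnegative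
  \<open>A\<^sub>k\<close> is infinitely divisible (\<open>infinitely_divisible_katti\<close>).

  The second formula for \<open>p\<^sub>n\<close> amounts to \<open>\<alpha> = \<Prod>k. (1 - \<alpha>\<^sup>k) ^ r\<^sub>k\<close>. Deleting the root of a rooted tree
  leaves a multiset of rooted trees, so \<open>T(x) = \<Sum>k. r\<^sub>k x\<^sup>k\<close> satisfies
  \<open>T(x) = x \<Prod>k. (1 - x\<^sup>k) powr (- r\<^sub>k)\<close>, and the claim becomes \<open>T(\<alpha>) = 1\<close>. Otter's limit relation
  enters through three facts: \<open>\<alpha> < 1\<close>, \<open>T(\<alpha>)\<close> is finite and \<open>\<alpha>\<close> is the radius of convergence of \<open>T\<close>; the
  last two use \<open>t\<^sub>n \<le> r\<^sub>n \<le> n t\<^sub>n\<close>. Separating the leading part of the logarithms, one gets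
  \<open>T(x) = c(x) exp (T(x))\<close> with \<open>c(x) = x exp (\<Sum>k. r\<^sub>k (- log (1 - x\<^sup>k) - x\<^sup>k))\<close>, where \<open>c\<close> is increasing and,
  its terms being of order \<open>r\<^sub>k x\<^sup>2\<^sup>k\<close>, still finite and continuous up to \<open>sqrt \<alpha> > \<alpha>\<close>. If \<open>T(\<alpha>) > 1\<close>, then
  \<open>log T - T = log c\<close> would increase near \<open>\<alpha>\<close>, although \<open>log y - y\<close> decreases for \<open>y > 1\<close>. If \<open>T(\<alpha>) < 1\<close>, then
  \<open>c(\<alpha>) e < 1\<close>, hence \<open>c(x) e \<le> 1\<close> for some \<open>x > \<alpha>\<close>, and then the inequality
  \<open>T\<^sub>N\<^sub>+\<^sub>1(x) \<le> c(x) exp (T\<^sub>N(x))\<close> for partial sums keeps all of them at most one, so that \<open>T\<close> converges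
  at \<open>x > \<alpha>\<close> (\<open>sum_at_radius_eq_1\<close>).

  Both decompositions into multisets are instances of one counting theorem (\<open>card_assembled\<close>) for graphs
  whose components belong to a given class of connected graphs. It admits graphs with loops, and
  a rooted tree is encoded by a loop at its root. A graph is free of cycles iff each of its
  edges is a bridge; this form of acyclicity only speaks of reachability and passes easily to
  components and through the insertion or deletion of a root.
\<close>

unbundle fps_syntax and no vec_syntax

section \<open>Generating functions of weighted multisets\<close>

definition weighted_msets :: "'c set \<Rightarrow> ('c \<Rightarrow> nat) \<Rightarrow> nat \<Rightarrow> 'c multiset set" where
  "weighted_msets C w n = {M. set_mset M \<subseteq> C \<and> (\<Sum>c\<in>#M. w c) = n}"

text \<open>
  A multiset over the larger set of colours either avoids the new colour or arises by adding one
  copy of it. This is the coefficient form of \<open>F\<^sub>C(x) = (1 - x\<^sup>w) F\<^bsub>insert c C\<^esub>(x)\<close>.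
\<close>
lemma weighted_msets_insert:
  assumes "c \<notin> C"
  shows "weighted_msets (insert c C) w n = weighted_msets C w n \<union>
     (if w c \<le> n then add_mset c ` weighted_msets (insert c C) w (n - w c) else {})"
    and "weighted_msets C w n \<inter> add_mset c ` weighted_msets (insert c C) w k = {}"
proof -
  show "weighted_msets (insert c C) w n = weighted_msets C w n \<union>
     (if w c \<le> n then add_mset c ` weighted_msets (insert c C) w (n - w c) else {})"
  proof (intro equalityI subsetI)
    fix M assume M: "M \<in> weighted_msets (insert c C) w n"
    show "M \<in> weighted_msets C w n \<union>
     (if w c \<le> n then add_mset c ` weighted_msets (insert c C) w (n - w c) else {})"
    proof (cases "c \<in># M")
      case True
      then obtain M' where "M = add_mset c M'" by (meson mset_add)
      then show ?thesis using M by (auto simp: weighted_msets_def)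
    next
      case False
      then show ?thesis using M by (auto simp: weighted_msets_def)
    qed
  qed (auto simp: weighted_msets_def split: if_splits)
  show "weighted_msets C w n \<inter> add_mset c ` weighted_msets (insert c C) w k = {}"
    using assms by (auto simp: weighted_msets_def)
qed

lemma finite_weighted_msets:
  assumes "finite C" "\<And>c. c \<in> C \<Longrightarrow> 0 < w c"
  shows "finite (weighted_msets C w n)"
  using assms
proof (induction C arbitrary: n rule: finite_induct)
  case empty
  have "weighted_msets {} w n \<subseteq> {{#}}" by (auto simp: weighted_msets_def)
  then show ?case by (rule finite_subset) simp
next
  case (insert c C)
  show ?case
  proof (induction n rule: less_induct)
    case (less n)
    have "finite (weighted_msets C w n)" using insert by auto
    moreover have "0 < w c" using insert.prems by simp
    ultimately show ?case
      using less by (subst weighted_msets_insert[OF insert(2)]) auto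
  qed
qed

lemma card_weighted_msets_insert:
  assumes "finite C" "\<And>c'. c' \<in> insert c C \<Longrightarrow> 0 < w c'" "c \<notin> C"
  shows "card (weighted_msets (insert c C) w n) = card (weighted_msets C w n) +
     (if w c \<le> n then card (weighted_msets (insert c C) w (n - w c)) else 0)"
proof -
  have fin: "finite (weighted_msets (insert c C) w k)" "finite (weighted_msets C w k)" for k
    using assms by (auto intro!: finite_weighted_msets)
  have "card (add_mset c ` weighted_msets (insert c C) w k) = card (weighted_msets (insert c C) w k)" for k
    by (intro card_image) (auto simp: inj_on_def)
  then show ?thesis
    using weighted_msets_insert(2)[OF assms(3), where n=n and w=w] fin
    by (subst weighted_msets_insert(1)[OF assms(3)]) (auto simp: card_Un_disjoint)
qed

abbreviation log_geom :: "real \<Rightarrow> real" where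
  "log_geom u \<equiv> - ln (1 - u)"

text \<open>
  Each colour contributes a geometric series \<open>1 / (1 - x\<^sup>w)\<close>. The product of these is written as the
  exponential of a sum, which is the form that carries over to infinitely many colours.
\<close>
lemma weighted_msets_sums:
  fixes x :: real
  assumes "finite C" "\<And>c. c \<in> C \<Longrightarrow> 0 < w c" and x: "0 \<le> x" "x < 1"
  shows "(\<lambda>n. real (card (weighted_msets C w n)) * x ^ n) sums exp (\<Sum>c\<in>C. log_geom (x ^ w c))"
  using assms(1,2)
proof (induction C rule: finite_induct)
  case empty
  have *: "weighted_msets {} w n = (if n = 0 then {{#}} else {})" for n
    by (auto simp: weighted_msets_def)
  have "(\<lambda>n. real (card (weighted_msets {} w n)) * x ^ n) sums (\<Sum>n\<in>{0}. real (card (weighted_msets {} w n)) * x ^ n)"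
    by (rule sums_finite) (auto simp: *)
  then show ?case by (simp add: *)
next
  case (insert c C)
  define k where "k = w c"
  define f where "f n = real (card (weighted_msets C w n)) * x ^ n" for n
  define g where "g n = real (card (weighted_msets (insert c C) w n)) * x ^ n" for n
  have k: "0 < k" using insert.prems by (simp add: k_def)
  have xk: "0 \<le> x ^ k" "x ^ k < 1" using x k by (auto simp: power_less_one_iff)
  have f: "f sums exp (\<Sum>c\<in>C. log_geom (x ^ w c))"
    unfolding f_def using insert by auto
  have fnn: "0 \<le> f n" and gnn: "0 \<le> g n" for n using x by (auto simp: f_def g_def)
  have rec1: "g n = f n" if "n < k" for n
    using card_weighted_msets_insert[OF insert(1) insert.prems insert(2), where n=n] that
    by (simp add: f_def g_def k_def)
  have rec2: "g (n + k) = f (n + k) + x ^ k * g n" for n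
    using card_weighted_msets_insert[OF insert(1) insert.prems insert(2), where n="n + k"]
    by (simp add: f_def g_def k_def power_add algebra_simps)
  \<comment> \<open>the relation between the two generating functions in terms of partial sums bounds those of g\<close>
  have part: "(\<Sum>i<n + k. g i) = (\<Sum>i<n + k. f i) + x ^ k * (\<Sum>i<n. g i)" for n
  proof (induction n)
    case 0 then show ?case using rec1 by simp
  next
    case (Suc n) then show ?case using rec2[of n] by (simp add: algebra_simps)
  qed
  have bound: "(\<Sum>i<n. g i) \<le> suminf f / (1 - x ^ k)" for n
  proof -
    have "(\<Sum>i<n. g i) \<le> (\<Sum>i<n + k. g i)"
      using gnn by (intro sum_mono2) auto
    also have "\<dots> \<le> suminf f + x ^ k * (\<Sum>i<n. g i)"
      unfolding part using fnn sums_summable[OF f] by (intro add_right_mono sum_le_suminf) auto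
    finally show ?thesis using xk by (simp add: field_simps)
  qed
  have sg: "summable g" by (rule summableI_nonneg_bounded[OF gnn bound])
  have "(\<lambda>n. \<Sum>i<n + k. g i) \<longlonglongrightarrow> suminf g"
    using summable_LIMSEQ[OF sg] by (rule LIMSEQ_ignore_initial_segment)
  moreover have "(\<lambda>n. (\<Sum>i<n + k. f i) + x ^ k * (\<Sum>i<n. g i)) \<longlonglongrightarrow> suminf f + x ^ k * suminf g"
    using f sg by (intro tendsto_intros summable_LIMSEQ LIMSEQ_ignore_initial_segment) (auto simp: sums_iff)
  ultimately have "suminf g = suminf f + x ^ k * suminf g"
    unfolding part by (rule LIMSEQ_unique)
  then have "suminf g = suminf f / (1 - x ^ k)" using xk by (simp add: field_simps)
  also have "\<dots> = exp (log_geom (x ^ k) + (\<Sum>c\<in>C. log_geom (x ^ w c)))"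
    using sums_unique[OF f] xk unfolding exp_add exp_minus by (simp add: field_simps)
  finally show ?case
    using sg insert(1,2) unfolding g_def k_def by (auto simp: sums_iff)
qed

definition weighted_gf :: "'c set \<Rightarrow> ('c \<Rightarrow> nat) \<Rightarrow> real fps" where
  "weighted_gf C w = Abs_fps (\<lambda>n. real (card (weighted_msets C w n)))"

text \<open>
  The coefficients of \<open>x F'(x) / F(x)\<close>: a colour of weight \<open>w\<close> contributes \<open>w x\<^sup>w / (1 - x\<^sup>w)\<close>.
\<close>
definition divisor_weight :: "'c set \<Rightarrow> ('c \<Rightarrow> nat) \<Rightarrow> nat \<Rightarrow> nat" where
  "divisor_weight C w n = (if n = 0 then 0 else \<Sum>c\<in>{c\<in>C. w c dvd n}. w c)"

lemma weighted_gf_log_deriv: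
  assumes "finite C" "\<And>c. c \<in> C \<Longrightarrow> 0 < w c"
  shows "fps_X * fps_deriv (weighted_gf C w) = Abs_fps (\<lambda>n. real (divisor_weight C w n)) * weighted_gf C w"
  using assms
proof (induction C rule: finite_induct)
  case empty
  have *: "weighted_msets {} w n = (if n = 0 then {{#}} else {})" for n
    by (auto simp: weighted_msets_def)
  have "weighted_gf {} w = 1"
    by (rule fps_ext) (simp add: weighted_gf_def *)
  moreover have "Abs_fps (\<lambda>n. real (divisor_weight {} w n)) = 0"
    by (rule fps_ext) (simp add: divisor_weight_def)
  ultimately show ?case by simp
next
  case (insert c C)
  define k where "k = w c"
  have k: "0 < k" using insert.prems by (simp add: k_def)
  define D :: "real fps" where "D = Abs_fps (\<lambda>n. if n > 0 \<and> k dvd n then real k else 0)"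
  define F where "F = weighted_gf (insert c C) w"
  define A where "A = Abs_fps (\<lambda>n. real (divisor_weight C w n))"
  \<comment> \<open>as a power series, D is k times the geometric series of X to the power k without its constant term\<close>
  have D: "D * (1 - fps_X ^ k) = of_nat k * fps_X ^ k"
  proof (rule fps_ext)
    fix n
    have "k dvd n - k \<longleftrightarrow> k dvd n" if "k < n" for n using that by (simp add: dvd_minus_self)
    moreover have "\<not> k dvd n" if "0 < n" "n < k" using that by (simp add: nat_dvd_not_less)
    ultimately show "(D * (1 - fps_X ^ k)) $ n = (of_nat k * fps_X ^ k) $ n"
      using k by (auto simp: D_def right_diff_distrib fps_X_power_mult_right_nth fps_mult_of_nat_nth fps_X_power_nth)
  qed
  have F: "weighted_gf C w = F * (1 - fps_X ^ k)"
  proof (rule fps_ext)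
    fix n
    show "weighted_gf C w $ n = (F * (1 - fps_X ^ k)) $ n"
      using card_weighted_msets_insert[OF insert(1) insert.prems insert(2), where n=n]
      by (auto simp: F_def weighted_gf_def k_def right_diff_distrib fps_X_power_mult_right_nth)
  qed
  have A: "Abs_fps (\<lambda>n. real (divisor_weight (insert c C) w n)) = A + D"
  proof (rule fps_ext)
    fix n
    have "{c'. (c' = c \<or> c' \<in> C) \<and> w c' dvd n} = (if w c dvd n then insert c {c'\<in>C. w c' dvd n} else {c'\<in>C. w c' dvd n})"
      by auto
    then show "Abs_fps (\<lambda>n. real (divisor_weight (insert c C) w n)) $ n = (A + D) $ n"
      using insert(1,2) by (auto simp: A_def D_def divisor_weight_def k_def)
  qed
  have IH: "fps_X * fps_deriv (F * (1 - fps_X ^ k)) = A * (F * (1 - fps_X ^ k))"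
    using insert unfolding F[symmetric] A_def by auto
  have dX: "fps_X * fps_deriv (fps_X ^ k :: real fps) = of_nat k * fps_X ^ k"
    by (rule fps_ext) (simp add: fps_mult_fps_X_deriv_shift fps_mult_of_nat_nth fps_X_power_nth)
  have "(1 - fps_X ^ k) * (fps_X * fps_deriv F) = fps_X * fps_deriv (F * (1 - fps_X ^ k)) + F * (fps_X * fps_deriv (fps_X ^ k))"
    by (simp add: algebra_simps)
  also have "\<dots> = (1 - fps_X ^ k) * ((A + D) * F)"
    unfolding IH dX D[symmetric] by (simp add: algebra_simps)
  finally have "(1 - fps_X ^ k) * (fps_X * fps_deriv F) = (1 - fps_X ^ k) * ((A + D) * F)" .
  moreover have "(1 - fps_X ^ k :: real fps) \<noteq> 0"
  proof -
    have "(1 - fps_X ^ k :: real fps) $ 0 = 1" using k by simp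
    then show ?thesis by (metis fps_zero_nth zero_neq_one)
  qed
  ultimately have "fps_X * fps_deriv F = (A + D) * F" by simp
  then show ?case using A by (simp add: F_def)
qed

text \<open>
  Infinitely many colours, but only finitely many of each weight. Questions about multisets of
  weight at most \<open>N\<close> only involve the finitely many colours of weight at most \<open>N\<close>.
\<close>
locale weighted_colours =
  fixes C :: "'c set" and w :: "'c \<Rightarrow> nat"
  assumes weight_pos: "c \<in> C \<Longrightarrow> 0 < w c"
    and finite_fibre: "finite {c\<in>C. w c = k}"
begin

definition num_colours :: "nat \<Rightarrow> nat" where
  "num_colours k = card {c\<in>C. w c = k}"

definition num_msets :: "nat \<Rightarrow> nat" where
  "num_msets n = card (weighted_msets C w n)"

definition light :: "nat \<Rightarrow> 'c set" where
  "light N = {c\<in>C. w c \<le> N}"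

lemma num_colours_0: "num_colours 0 = 0"
  using weight_pos by (auto simp: num_colours_def card_eq_0_iff)

lemma finite_light: "finite (light N)"
proof -
  have "light N = (\<Union>k\<in>{..N}. {c\<in>C. w c = k})" by (auto simp: light_def)
  then show ?thesis using finite_fibre by simp
qed

lemma light_pos: "c \<in> light N \<Longrightarrow> 0 < w c"
  using weight_pos by (simp add: light_def)

lemma weighted_msets_light:
  assumes "n \<le> N" shows "weighted_msets (light N) w n = weighted_msets C w n"
proof -
  have "w c \<le> (\<Sum>c\<in>#M. w c)" if "c \<in># M" for c M
    using that by (metis insert_DiffM image_mset_add_mset sum_mset.add_mset le_add1)
  then show ?thesis
    using assms by (fastforce simp: weighted_msets_def light_def)
qed

lemma weighted_msets_light_le: "card (weighted_msets (light N) w n) \<le> num_msets n"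
proof -
  have "finite (weighted_msets C w n)"
    unfolding weighted_msets_light[OF order_refl, symmetric]
    by (intro finite_weighted_msets finite_light light_pos)
  then show ?thesis unfolding num_msets_def
    by (rule card_mono) (auto simp: weighted_msets_def light_def)
qed

lemma sum_light: "(\<Sum>c\<in>light N. h (w c)) = (\<Sum>k\<le>N. real (num_colours k) * h k)"
proof -
  have "(\<Sum>k\<in>{..N}. \<Sum>c\<in>{c\<in>light N. w c = k}. h (w c)) = (\<Sum>c\<in>light N. h (w c))"
    by (rule sum.group[OF finite_light]) (auto simp: light_def)
  moreover have "{c\<in>light N. w c = k} = {c\<in>C. w c = k}" if "k \<le> N" for k
    using that by (auto simp: light_def)
  ultimately show ?thesis by (simp add: num_colours_def)
qed

text \<open>
  The colours of weight at most \<open>N\<close> suffice for all multisets of weight at most \<open>N\<close>, so the left-hand side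
  is a partial sum of their generating function. The bound serves to prove that the full series
  converges.
\<close>
lemma num_msets_partial_sum_le:
  assumes x: "0 \<le> x" "x < 1"
  shows "(\<Sum>n\<le>N. real (num_msets n) * x ^ n) \<le> exp (\<Sum>k\<le>N. real (num_colours k) * log_geom (x ^ k))"
proof -
  have s: "(\<lambda>n. real (card (weighted_msets (light N) w n)) * x ^ n) sums exp (\<Sum>c\<in>light N. log_geom (x ^ w c))"
    by (rule weighted_msets_sums[OF finite_light light_pos x])
  have "(\<Sum>n\<le>N. real (num_msets n) * x ^ n) = (\<Sum>n\<le>N. real (card (weighted_msets (light N) w n)) * x ^ n)"
    by (simp add: num_msets_def weighted_msets_light)
  also have "\<dots> \<le> exp (\<Sum>c\<in>light N. log_geom (x ^ w c))"
    unfolding sums_unique[OF s] using s x by (intro sum_le_suminf) (auto simp: sums_iff)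
  finally show ?thesis by (simp add: sum_light[where h="\<lambda>k. log_geom (x ^ k)"])
qed

text \<open>
  Squeezing: partial sums of the series are bounded by the exponential, and the exponential of a
  partial sum is the generating function of the light colours, which is dominated by the series.
\<close>
lemma num_msets_sums:
  assumes x: "0 \<le> x" "x < 1" and summ: "summable (\<lambda>k. real (num_colours k) * log_geom (x ^ k))"
  shows "(\<lambda>n. real (num_msets n) * x ^ n) sums exp (\<Sum>k. real (num_colours k) * log_geom (x ^ k))"
proof -
  let ?f = "\<lambda>n. real (num_msets n) * x ^ n"
  let ?g = "\<lambda>k. real (num_colours k) * log_geom (x ^ k)"
  have gnn: "0 \<le> ?g k" for k
  proof (cases "k = 0")
    case False
    then have "x ^ k < 1" using x by (simp add: power_less_one_iff)
    then show ?thesis using x by (simp add: ln_le_zero_iff mult_nonneg_nonpos)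
  qed (simp add: num_colours_0)
  have fnn: "0 \<le> ?f n" for n using x by simp
  have "(\<Sum>n<N. ?f n) \<le> exp (suminf ?g)" for N
  proof -
    have "(\<Sum>n<N. ?f n) \<le> (\<Sum>n\<le>N. ?f n)" using fnn by (intro sum_mono2) auto
    also have "\<dots> \<le> exp (\<Sum>k\<le>N. ?g k)" using num_msets_partial_sum_le[OF x] .
    also have "\<dots> \<le> exp (suminf ?g)" using gnn summ by (auto intro: sum_le_suminf)
    finally show ?thesis .
  qed
  then have sf: "summable ?f" and le: "suminf ?f \<le> exp (suminf ?g)"
    using summableI_nonneg_bounded[of ?f] suminf_le_const[of ?f] fnn by blast+
  have "exp (\<Sum>k\<le>N. ?g k) \<le> suminf ?f" for N
  proof -
    have s: "(\<lambda>n. real (card (weighted_msets (light N) w n)) * x ^ n) sums exp (\<Sum>c\<in>light N. log_geom (x ^ w c))"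
      by (rule weighted_msets_sums[OF finite_light light_pos x])
    have "exp (\<Sum>c\<in>light N. log_geom (x ^ w c)) \<le> suminf ?f"
      unfolding sums_unique[OF s] using s sf x weighted_msets_light_le
      by (intro suminf_le) (auto simp: sums_iff intro!: mult_right_mono)
    then show ?thesis by (simp add: sum_light[where h="\<lambda>k. log_geom (x ^ k)"])
  qed
  moreover have "(\<lambda>N. exp (\<Sum>k\<le>N. ?g k)) \<longlonglongrightarrow> exp (suminf ?g)"
    using summable_LIMSEQ'[OF summ] by (rule tendsto_exp)
  ultimately have "exp (suminf ?g) \<le> suminf ?f"
    by (intro LIMSEQ_le_const2) auto
  with le sf show ?thesis by (simp add: sums_iff)
qed

lemma num_msets_recurrence:
  "real n * real (num_msets n) = (\<Sum>k\<le>n. real (divisor_weight C w k) * real (num_msets (n - k)))"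
proof -
  have eq: "divisor_weight (light n) w k = divisor_weight C w k" if "k \<le> n" for k
  proof (cases "k = 0")
    case False
    then have "{c \<in> light n. w c dvd k} = {c \<in> C. w c dvd k}"
      using that False by (auto simp: light_def dest: dvd_imp_le)
    then show ?thesis by (simp add: divisor_weight_def)
  qed (simp add: divisor_weight_def)
  have "(fps_X * fps_deriv (weighted_gf (light n) w)) $ n =
      (Abs_fps (\<lambda>k. real (divisor_weight (light n) w k)) * weighted_gf (light n) w) $ n"
    by (subst weighted_gf_log_deriv[OF finite_light light_pos]) auto
  then show ?thesis
    by (simp add: fps_mult_fps_X_deriv_shift fps_mult_nth weighted_gf_def num_msets_def weighted_msets_light eq atLeast0AtMost)
qed

end

section \<open>Graphs and their components\<close>

text \<open>
  Two maps on the same set are compared through their kernels. In this way numbers of isomorphism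
  classes are compared without choosing representatives.
\<close>
lemma card_image_le_of_kernel:
  assumes "finite A" "\<And>a b. a \<in> A \<Longrightarrow> b \<in> A \<Longrightarrow> f a = f b \<Longrightarrow> g a = g b"
  shows "card (g ` A) \<le> card (f ` A)"
proof -
  have "g a = g (inv_into A f (f a))" if "a \<in> A" for a
    using that by (intro assms(2)) (auto simp: inv_into_into f_inv_into_f)
  then have "g ` A = (g \<circ> inv_into A f) ` f ` A"
    unfolding image_comp by (intro image_cong) auto
  then show ?thesis using assms(1) by (metis card_image_le finite_imageI)
qed

lemma card_image_eq_of_kernel:
  assumes "finite A" "\<And>a b. a \<in> A \<Longrightarrow> b \<in> A \<Longrightarrow> f a = f b \<longleftrightarrow> g a = g b"
  shows "card (f ` A) = card (g ` A)"
  using assms by (intro antisym card_image_le_of_kernel) blast+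

lemma quotient_eq_image: "A // r = (\<lambda>x. r `` {x}) ` A"
  by (auto simp: quotient_def)

text \<open>
  Graphs that may have loops. A loop marks the root of a tree, so that graphs with roots in
  some components need no separate notion of isomorphism.
\<close>
definition loop_graph :: "'a set \<Rightarrow> ('a \<times> 'a) set \<Rightarrow> bool" where
  "loop_graph V E \<longleftrightarrow> finite V \<and> E \<subseteq> V \<times> V \<and> sym E"

lemma graph_iso_refl: "graph_iso id V E V E"
  by (simp add: graph_iso_def map_prod.id)

lemma graph_iso_trans:
  "graph_iso \<phi> V E W F \<Longrightarrow> graph_iso \<psi> W F U G \<Longrightarrow> graph_iso (\<psi> \<circ> \<phi>) V E U G"
  unfolding graph_iso_def by (metis bij_betw_trans image_comp map_prod.comp)

lemma graph_iso_cong: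
  assumes "\<And>v. v \<in> V \<Longrightarrow> \<phi> v = \<psi> v" "E \<subseteq> V \<times> V"
  shows "graph_iso \<phi> V E W F \<longleftrightarrow> graph_iso \<psi> V E W F"
proof -
  have "map_prod \<phi> \<phi> ` E = map_prod \<psi> \<psi> ` E"
    using assms by (intro image_cong) auto
  then show ?thesis
    using assms(1) by (simp add: graph_iso_def cong: bij_betw_cong)
qed

lemma graph_iso_inv:
  assumes "graph_iso \<phi> V E W F" "E \<subseteq> V \<times> V"
  shows "graph_iso (inv_into V \<phi>) W F V E"
proof -
  have b: "bij_betw \<phi> V W" and F: "map_prod \<phi> \<phi> ` E = F"
    using assms by (auto simp: graph_iso_def)
  have "map_prod (inv_into V \<phi>) (inv_into V \<phi>) ` F = map_prod id id ` E"
    unfolding F[symmetric] image_comp map_prod.comp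
  proof (rule image_cong)
    fix e assume "e \<in> E"
    then have "fst e \<in> V" "snd e \<in> V" using assms(2) by auto
    then show "(map_prod (inv_into V \<phi> \<circ> \<phi>) (inv_into V \<phi> \<circ> \<phi>)) e = map_prod id id e"
      using b by (cases e) (simp add: bij_betw_inv_into_left)
  qed simp
  then show ?thesis
    using b by (simp add: graph_iso_def bij_betw_inv_into map_prod.id)
qed

lemma graph_iso_edges_subset: "graph_iso \<phi> V E W F \<Longrightarrow> E \<subseteq> V \<times> V \<Longrightarrow> F \<subseteq> W \<times> W"
  by (auto simp: graph_iso_def bij_betw_def)

lemma graph_iso_restrict:
  assumes "graph_iso \<phi> V E W F" "E \<subseteq> V \<times> V" "C \<subseteq> V"
  shows "graph_iso \<phi> C (E \<inter> C \<times> C) (\<phi> ` C) (F \<inter> (\<phi> ` C) \<times> (\<phi> ` C))"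
proof -
  have inj: "inj_on \<phi> V" and F: "F = map_prod \<phi> \<phi> ` E"
    using assms(1) by (auto simp: graph_iso_def bij_betw_def)
  have C: "v \<in> C" if "v \<in> V" "\<phi> v \<in> \<phi> ` C" for v
    using that inj assms(3) by (auto dest: inj_onD)
  have "map_prod \<phi> \<phi> ` (E \<inter> C \<times> C) = F \<inter> (\<phi> ` C) \<times> (\<phi> ` C)"
  proof (intro equalityI subrelI)
    fix a b assume "(a, b) \<in> F \<inter> (\<phi> ` C) \<times> (\<phi> ` C)"
    then have ab: "(a, b) \<in> map_prod \<phi> \<phi> ` E" "a \<in> \<phi> ` C" "b \<in> \<phi> ` C" unfolding F by blast+
    then obtain u v where uv: "(u, v) \<in> E" "a = \<phi> u" "b = \<phi> v" by auto
    have "u \<in> C" "v \<in> C"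
      using C[of u] C[of v] ab(2,3) uv assms(2) by auto
    then show "(a, b) \<in> map_prod \<phi> \<phi> ` (E \<inter> C \<times> C)"
      using uv by (intro image_eqI[of _ _ "(u, v)"]) auto
  qed (auto simp: F)
  moreover have "bij_betw \<phi> C (\<phi> ` C)"
    using inj assms(3) by (auto simp: bij_betw_def inj_on_subset)
  ultimately show ?thesis by (simp add: graph_iso_def)
qed

lemma graph_iso_rtrancl:
  assumes "graph_iso \<phi> V E W F" "(u, v) \<in> E\<^sup>*"
  shows "(\<phi> u, \<phi> v) \<in> F\<^sup>*"
  using assms(2)
proof induction
  case (step y z)
  then have "(\<phi> y, \<phi> z) \<in> F" using assms(1) by (force simp: graph_iso_def)
  with step show ?case by simp
qed simp

lemma graph_iso_rtrancl_iff:
  assumes "graph_iso \<phi> V E W F" "E \<subseteq> V \<times> V" "u \<in> V" "v \<in> V"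
  shows "(\<phi> u, \<phi> v) \<in> F\<^sup>* \<longleftrightarrow> (u, v) \<in> E\<^sup>*"
proof
  assume "(\<phi> u, \<phi> v) \<in> F\<^sup>*"
  then have "(inv_into V \<phi> (\<phi> u), inv_into V \<phi> (\<phi> v)) \<in> E\<^sup>*"
    using graph_iso_inv[OF assms(1,2)] by (rule graph_iso_rtrancl[rotated])
  then show "(u, v) \<in> E\<^sup>*"
    using assms by (simp add: graph_iso_def bij_betw_def inv_into_f_f)
qed (rule graph_iso_rtrancl[OF assms(1)])

lemma graph_iso_loop_graph:
  assumes "graph_iso \<phi> V E W F" "loop_graph V E" shows "loop_graph W F"
proof -
  have "sym F" using assms unfolding graph_iso_def loop_graph_def sym_def by force
  then show ?thesis
    using assms graph_iso_edges_subset[OF assms(1)]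
    by (auto simp: loop_graph_def graph_iso_def bij_betw_finite)
qed

text \<open>
  A complete isomorphism invariant, comparable between graphs on different vertex sets: the order
  of the graph together with all its copies on an initial segment of the natural numbers.
\<close>
definition iso_class :: "'a set \<Rightarrow> ('a \<times> 'a) set \<Rightarrow> nat \<times> (nat \<times> nat) set set" where
  "iso_class V E = (card V, {F. \<exists>\<phi>. graph_iso \<phi> V E {..<card V} F})"

lemma ex_standard_copy:
  assumes "finite V" shows "\<exists>\<phi> F. graph_iso \<phi> V E {..<card V} F"
  using ex_bij_betw_finite_nat[OF assms] by (auto simp: graph_iso_def atLeast0LessThan)

lemma iso_class_eq_iff:
  assumes "finite V" "finite W" "E \<subseteq> V \<times> V" "F \<subseteq> W \<times> W"
  shows "iso_class V E = iso_class W F \<longleftrightarrow> (\<exists>\<phi>. graph_iso \<phi> V E W F)"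
proof
  assume eq: "iso_class V E = iso_class W F"
  obtain \<phi> G where \<phi>: "graph_iso \<phi> V E {..<card V} G" using ex_standard_copy[OF assms(1)] by blast
  then obtain \<psi> where \<psi>: "graph_iso \<psi> W F {..<card W} G"
    using eq unfolding iso_class_def prod.inject by blast
  have "card V = card W" using eq by (simp add: iso_class_def)
  then show "\<exists>\<phi>. graph_iso \<phi> V E W F"
    using graph_iso_trans[OF \<phi>, of "inv_into W \<psi>" W F] graph_iso_inv[OF \<psi> assms(4)] by auto
next
  assume "\<exists>\<phi>. graph_iso \<phi> V E W F"
  then obtain \<phi> where \<phi>: "graph_iso \<phi> V E W F" ..
  then have "card V = card W" by (auto simp: graph_iso_def bij_betw_same_card)
  then show "iso_class V E = iso_class W F"
    using graph_iso_trans[OF \<phi>] graph_iso_trans[OF graph_iso_inv[OF \<phi> assms(3)]]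
    unfolding iso_class_def by (intro prod_eqI set_eqI) (simp, simp, blast)
qed

lemma iso_class_lessThan: "iso_class {..<n} E = (n, iso_rel n `` {E})"
  by (auto simp: iso_class_def iso_rel_def)

lemma card_quotient_iso_rel: "card (A // iso_rel n) = card (iso_class {..<n} ` A)"
proof -
  have "iso_class {..<n} ` A = Pair n ` (A // iso_rel n)"
    by (auto simp: quotient_def iso_class_lessThan)
  then show ?thesis by (simp add: card_image inj_on_def)
qed

definition graph_components :: "'a set \<Rightarrow> ('a \<times> 'a) set \<Rightarrow> 'a set set" where
  "graph_components V E = (\<lambda>v. E\<^sup>* `` {v}) ` V"

lemma loop_graph_rtrancl_sym: "loop_graph V E \<Longrightarrow> (u, v) \<in> E\<^sup>* \<Longrightarrow> (v, u) \<in> E\<^sup>*"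
  unfolding loop_graph_def by (meson sym_rtrancl symD)

lemma rtrancl_stays: "E \<subseteq> V \<times> V \<Longrightarrow> (u, v) \<in> E\<^sup>* \<Longrightarrow> u \<in> V \<Longrightarrow> v \<in> V"
  by (rotate_tac 1, induction rule: rtrancl_induct) auto

lemma component_subset: "E \<subseteq> V \<times> V \<Longrightarrow> C \<in> graph_components V E \<Longrightarrow> C \<subseteq> V"
  using rtrancl_stays[of E V] by (auto simp: graph_components_def)

lemma component_nonempty: "C \<in> graph_components V E \<Longrightarrow> C \<noteq> {}"
  by (auto simp: graph_components_def)

lemma Union_components: "E \<subseteq> V \<times> V \<Longrightarrow> \<Union>(graph_components V E) = V"
  using component_subset[of E V] by (auto simp: graph_components_def)

lemma finite_components: "finite V \<Longrightarrow> finite (graph_components V E)"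
  by (simp add: graph_components_def)

lemma component_eq:
  assumes "loop_graph V E" "C \<in> graph_components V E" "u \<in> C" shows "C = E\<^sup>* `` {u}"
  using assms(2,3) loop_graph_rtrancl_sym[OF assms(1)]
  by (auto simp: graph_components_def intro: rtrancl_trans)

lemma component_closed:
  assumes "loop_graph V E" "C \<in> graph_components V E" "u \<in> C" shows "(u, v) \<in> E\<^sup>* \<longleftrightarrow> v \<in> C"
  using component_eq[OF assms] by auto

lemma components_disjoint:
  assumes "loop_graph V E" "C \<in> graph_components V E" "D \<in> graph_components V E" "u \<in> C" "u \<in> D"
  shows "C = D"
  using component_eq[OF assms(1,2,4)] component_eq[OF assms(1,3,5)] by simp

text \<open>
  A walk that starts in a set which no edge leaves uses only edges inside this set.
\<close>
lemma closed_set_rtrancl: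
  assumes "\<And>x y. x \<in> C \<Longrightarrow> (x, y) \<in> E \<Longrightarrow> y \<in> C" "(u, v) \<in> E\<^sup>*" "u \<in> C"
  shows "(u, v) \<in> (E \<inter> C \<times> C)\<^sup>* \<and> v \<in> C"
  using assms(2,3)
proof induction
  case (step y z)
  then have "(y, z) \<in> E \<inter> C \<times> C" using assms(1) by auto
  with step show ?case by (auto intro: rtrancl_into_rtrancl)
qed simp

lemma component_connected:
  assumes "loop_graph V E" "C \<in> graph_components V E" "u \<in> C" "v \<in> C"
  shows "(u, v) \<in> (E \<inter> C \<times> C)\<^sup>*"
proof -
  have "y \<in> C" if "x \<in> C" "(x, y) \<in> E" for x y
    using that component_closed[OF assms(1,2)] by blast
  moreover have "(u, v) \<in> E\<^sup>*" using component_closed[OF assms(1-3)] assms(4) by simp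
  ultimately show ?thesis using closed_set_rtrancl[of C E u v] assms(3) by blast
qed

lemma edges_Union_components:
  assumes "loop_graph V E" shows "E = (\<Union>C\<in>graph_components V E. E \<inter> C \<times> C)"
proof -
  have "\<exists>C\<in>graph_components V E. u \<in> C \<and> v \<in> C" if "(u, v) \<in> E" for u v
  proof -
    have "u \<in> V" using that assms by (auto simp: loop_graph_def)
    then have "E\<^sup>* `` {u} \<in> graph_components V E" by (auto simp: graph_components_def)
    then show ?thesis using that by (intro bexI[of _ "E\<^sup>* `` {u}"]) auto
  qed
  then have "E \<subseteq> (\<Union>C\<in>graph_components V E. E \<inter> C \<times> C)"
    by (intro subrelI) (meson IntI SigmaI UN_I)
  then show ?thesis by (intro equalityI) blast+
qed

lemma connected_components:
  assumes "E \<subseteq> V \<times> V" "V \<noteq> {}" "\<And>u v. u \<in> V \<Longrightarrow> v \<in> V \<Longrightarrow> (u, v) \<in> E\<^sup>*"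
  shows "graph_components V E = {V}"
proof -
  have "E\<^sup>* `` {v} = V" if "v \<in> V" for v
    using rtrancl_stays[OF assms(1) _ that] assms(3)[OF that] by blast
  then have "(\<lambda>v. E\<^sup>* `` {v}) ` V = (\<lambda>v. V) ` V" by (rule image_cong[OF refl])
  then show ?thesis using assms(2) by (simp add: graph_components_def image_constant_conv)
qed

lemma components_disjoint_Un:
  assumes "E \<subseteq> V \<times> V" "F \<subseteq> W \<times> W" "V \<inter> W = {}"
  shows "graph_components (V \<union> W) (E \<union> F) = graph_components V E \<union> graph_components W F"
    and "C \<in> graph_components V E \<Longrightarrow> (E \<union> F) \<inter> C \<times> C = E \<inter> C \<times> C"
    and "C \<in> graph_components W F \<Longrightarrow> (E \<union> F) \<inter> C \<times> C = F \<inter> C \<times> C"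
    and "graph_components V E \<inter> graph_components W F = {}"
proof -
  have *: "(E \<union> F)\<^sup>* `` {v} = E\<^sup>* `` {v}" if "v \<in> V" "E \<subseteq> V \<times> V" "F \<subseteq> W \<times> W" "V \<inter> W = {}"
    for v V W and E F :: "('a \<times> 'a) set"
  proof -
    have "(v, u) \<in> E\<^sup>*" if "(v, u) \<in> (E \<union> F)\<^sup>*" for u
    proof -
      have "(v, u) \<in> ((E \<union> F) \<inter> V \<times> V)\<^sup>*"
        using closed_set_rtrancl[of V "E \<union> F" v u] that \<open>v \<in> V\<close> \<open>E \<subseteq> V \<times> V\<close> \<open>F \<subseteq> W \<times> W\<close> \<open>V \<inter> W = {}\<close>
        by blast
      moreover have "(E \<union> F) \<inter> V \<times> V \<subseteq> E" using that \<open>F \<subseteq> W \<times> W\<close> \<open>V \<inter> W = {}\<close> by blast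
      ultimately show ?thesis by (meson rtrancl_mono subsetD)
    qed
    moreover have "E\<^sup>* \<subseteq> (E \<union> F)\<^sup>*" by (rule rtrancl_mono) simp
    ultimately show ?thesis by blast
  qed
  have "(\<lambda>v. (E \<union> F)\<^sup>* `` {v}) ` V = graph_components V E"
    unfolding graph_components_def using *[OF _ assms] by (intro image_cong) auto
  moreover have "(\<lambda>v. (E \<union> F)\<^sup>* `` {v}) ` W = graph_components W F"
    unfolding graph_components_def using *[of _ W F E V] assms by (intro image_cong) (auto simp: Un_commute)
  ultimately show "graph_components (V \<union> W) (E \<union> F) = graph_components V E \<union> graph_components W F"
    by (simp add: graph_components_def image_Un)
  show "C \<in> graph_components V E \<Longrightarrow> (E \<union> F) \<inter> C \<times> C = E \<inter> C \<times> C"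
    using component_subset[OF assms(1)] assms by blast
  show "C \<in> graph_components W F \<Longrightarrow> (E \<union> F) \<inter> C \<times> C = F \<inter> C \<times> C"
    using component_subset[OF assms(2)] assms by blast
  show "graph_components V E \<inter> graph_components W F = {}"
  proof (rule equals0I)
    fix C assume "C \<in> graph_components V E \<inter> graph_components W F"
    then have C: "C \<in> graph_components V E" "C \<in> graph_components W F" by auto
    show False
      using component_subset[OF assms(1) C(1)] component_subset[OF assms(2) C(2)]
        component_nonempty[OF C(1)] assms(3) by blast
  qed
qed

lemma graph_iso_components:
  assumes "graph_iso \<phi> V E W F" "E \<subseteq> V \<times> V"
  shows "graph_components W F = (\<lambda>C. \<phi> ` C) ` graph_components V E"
proof -
  have W: "W = \<phi> ` V" using assms by (auto simp: graph_iso_def bij_betw_def)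
  have F: "F \<subseteq> W \<times> W" using graph_iso_edges_subset[OF assms] .
  have "F\<^sup>* `` {\<phi> v} = \<phi> ` (E\<^sup>* `` {v})" if "v \<in> V" for v
  proof (intro equalityI subsetI)
    fix w assume "w \<in> F\<^sup>* `` {\<phi> v}"
    then have "(\<phi> v, w) \<in> F\<^sup>*" "w \<in> W" using rtrancl_stays[OF F] that W by auto
    then obtain u where "u \<in> V" "w = \<phi> u" using W by auto
    then show "w \<in> \<phi> ` (E\<^sup>* `` {v})"
      using graph_iso_rtrancl_iff[OF assms that] \<open>(\<phi> v, w) \<in> F\<^sup>*\<close> by auto
  qed (use graph_iso_rtrancl[OF assms(1)] in auto)
  then show ?thesis unfolding graph_components_def W image_image by (intro image_cong) auto
qed

definition component_classes :: "'a set \<Rightarrow> ('a \<times> 'a) set \<Rightarrow> (nat \<times> (nat \<times> nat) set set) multiset" where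
  "component_classes V E = image_mset (\<lambda>C. iso_class C (E \<inter> C \<times> C)) (mset_set (graph_components V E))"

lemma component_classes_iso:
  assumes "graph_iso \<phi> V E W F" "loop_graph V E"
  shows "component_classes V E = component_classes W F"
proof -
  have E: "E \<subseteq> V \<times> V" and fin: "finite V" using assms by (auto simp: loop_graph_def)
  have W: "loop_graph W F" using graph_iso_loop_graph[OF assms] .
  have inj: "inj_on (\<lambda>C. \<phi> ` C) (graph_components V E)"
  proof (rule inj_onI)
    fix C D assume "C \<in> graph_components V E" "D \<in> graph_components V E" "\<phi> ` C = \<phi> ` D"
    then show "C = D"
      using component_subset[OF E] assms(1) inj_on_image_eq_iff[of \<phi> V C D]
      by (auto simp: graph_iso_def bij_betw_def)
  qed
  have cls: "iso_class (\<phi> ` C) (F \<inter> (\<phi> ` C) \<times> (\<phi> ` C)) = iso_class C (E \<inter> C \<times> C)"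
    if "C \<in> graph_components V E" for C
  proof -
    have C: "C \<subseteq> V" using component_subset[OF E that] .
    have "finite C" using C fin by (rule finite_subset)
    then show ?thesis
      using graph_iso_restrict[OF assms(1) E C]
      by (subst eq_commute, subst iso_class_eq_iff) auto
  qed
  have "component_classes W F =
      image_mset (\<lambda>C. iso_class (\<phi> ` C) (F \<inter> (\<phi> ` C) \<times> (\<phi> ` C))) (mset_set (graph_components V E))"
    unfolding component_classes_def graph_iso_components[OF assms(1) E]
    by (subst image_mset_mset_set[OF inj, symmetric]) (simp add: multiset.map_comp comp_def)
  also have "\<dots> = component_classes V E"
    unfolding component_classes_def using finite_components[OF fin] by (intro image_mset_cong cls) simp
  finally show ?thesis ..
qed

lemma image_mset_set_eq_bij:
  assumes "finite A" "finite B" "image_mset f (mset_set A) = image_mset g (mset_set B)"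
  shows "\<exists>\<sigma>. bij_betw \<sigma> A B \<and> (\<forall>a\<in>A. g (\<sigma> a) = f a)"
  using assms
proof (induction A arbitrary: B rule: finite_induct)
  case empty
  then have "B = {}" by (simp add: mset_set_empty_iff)
  then show ?case by (auto simp: bij_betw_def)
next
  case (insert a A)
  have "f a \<in># image_mset g (mset_set B)"
    using insert by (metis image_mset_add_mset mset_set.insert union_single_eq_member)
  then obtain b where b: "b \<in> B" "g b = f a" using insert.prems by auto
  have "mset_set B = add_mset b (mset_set (B - {b}))"
    using b insert.prems(1) by (metis mset_set.remove)
  then have "image_mset f (mset_set A) = image_mset g (mset_set (B - {b}))"
    using insert b by simp
  then obtain \<sigma> where \<sigma>: "bij_betw \<sigma> A (B - {b})" "\<forall>a\<in>A. g (\<sigma> a) = f a"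
    using insert.IH[of "B - {b}"] insert.prems by auto
  have "bij_betw (\<sigma>(a := b)) (insert a A) (insert b (B - {b}))"
    using \<sigma>(1) insert(2) by (intro bij_betw_combine[of _ "{a}" "{b}", simplified])
      (auto simp: bij_betw_def inj_on_def)
  then have "bij_betw (\<sigma>(a := b)) (insert a A) B" using b(1) by (simp add: insert_absorb)
  moreover have "\<forall>x\<in>insert a A. g ((\<sigma>(a := b)) x) = f x" using \<sigma>(2) b(2) insert(2) by auto
  ultimately show ?case by blast
qed

text \<open>
  Match the components of both graphs in isomorphic pairs and glue the isomorphisms of the pairs.
\<close>
lemma iso_of_component_classes_eq:
  assumes V: "loop_graph V E" and W: "loop_graph W F"
    and eq: "component_classes V E = component_classes W F"
  shows "\<exists>\<phi>. graph_iso \<phi> V E W F"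
proof -
  have E: "E \<subseteq> V \<times> V" "finite V" and F: "F \<subseteq> W \<times> W" "finite W"
    using V W by (auto simp: loop_graph_def)
  obtain \<sigma> where bij: "bij_betw \<sigma> (graph_components V E) (graph_components W F)"
    and cls: "\<And>C. C \<in> graph_components V E \<Longrightarrow> iso_class (\<sigma> C) (F \<inter> \<sigma> C \<times> \<sigma> C) = iso_class C (E \<inter> C \<times> C)"
    using image_mset_set_eq_bij[OF finite_components finite_components, OF E(2) F(2) eq[unfolded component_classes_def]]
    by blast
  have \<sigma>: "\<sigma> C \<in> graph_components W F" if "C \<in> graph_components V E" for C
    using bij that by (auto simp: bij_betw_def)
  have "\<exists>\<psi>. graph_iso \<psi> C (E \<inter> C \<times> C) (\<sigma> C) (F \<inter> \<sigma> C \<times> \<sigma> C)" if "C \<in> graph_components V E" for C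
    using cls[OF that] component_subset[OF E(1) that] component_subset[OF F(1) \<sigma>[OF that]] E(2) F(2)
    by (subst iso_class_eq_iff[symmetric]) (auto intro: finite_subset)
  then obtain \<psi> where \<psi>: "\<And>C. C \<in> graph_components V E \<Longrightarrow> graph_iso (\<psi> C) C (E \<inter> C \<times> C) (\<sigma> C) (F \<inter> \<sigma> C \<times> \<sigma> C)"
    by metis
  \<comment> \<open>on each component, follow the isomorphism chosen for it\<close>
  define \<phi> where "\<phi> v = \<psi> (E\<^sup>* `` {v}) v" for v
  have \<phi>: "graph_iso \<phi> C (E \<inter> C \<times> C) (\<sigma> C) (F \<inter> \<sigma> C \<times> \<sigma> C)" if "C \<in> graph_components V E" for C
  proof (rule iffD2[OF graph_iso_cong \<psi>[OF that]])
    show "\<phi> v = \<psi> C v" if "v \<in> C" for v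
      using component_eq[OF V \<open>C \<in> graph_components V E\<close> that] by (simp add: \<phi>_def)
  qed auto
  have "bij_betw \<phi> (\<Union>C\<in>graph_components V E. C) (\<Union>C\<in>graph_components V E. \<sigma> C)"
  proof (rule bij_betw_UNION_disjoint)
    show "disjoint_family_on \<sigma> (graph_components V E)"
      unfolding disjoint_family_on_def
      using components_disjoint[OF W] \<sigma> bij by (metis bij_betw_def disjoint_iff inj_onD)
    show "bij_betw \<phi> C (\<sigma> C)" if "C \<in> graph_components V E" for C
      using \<phi>[OF that] by (simp add: graph_iso_def)
  qed
  moreover have img: "\<sigma> ` graph_components V E = graph_components W F" using bij by (simp add: bij_betw_def)
  ultimately have "bij_betw \<phi> V W"
    using Union_components[OF E(1)] Union_components[OF F(1)] by simp
  moreover have "map_prod \<phi> \<phi> ` E = F"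
  proof -
    have "map_prod \<phi> \<phi> ` E = (\<Union>C\<in>graph_components V E. map_prod \<phi> \<phi> ` (E \<inter> C \<times> C))"
      unfolding image_UN[symmetric] edges_Union_components[OF V, symmetric] ..
    also have "\<dots> = (\<Union>C\<in>graph_components V E. F \<inter> \<sigma> C \<times> \<sigma> C)"
      using \<phi> by (intro SUP_cong) (auto simp: graph_iso_def)
    also have "\<dots> = (\<Union>D\<in>graph_components W F. F \<inter> D \<times> D)"
      unfolding img[symmetric] by simp
    also have "\<dots> = F" using edges_Union_components[OF W] by simp
    finally show ?thesis .
  qed
  ultimately show ?thesis by (auto simp: graph_iso_def)
qed

lemma component_classes_weight:
  assumes "loop_graph V E" shows "(\<Sum>c\<in>#component_classes V E. fst c) = card V"
proof -
  have E: "E \<subseteq> V \<times> V" "finite V" using assms by (auto simp: loop_graph_def)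
  have "(\<Sum>c\<in>#component_classes V E. fst c) = (\<Sum>C\<in>graph_components V E. card C)"
    by (simp add: component_classes_def multiset.map_comp comp_def iso_class_def sum_unfold_sum_mset)
  also have "\<dots> = card (\<Union>(graph_components V E))"
  proof (rule card_Union_disjoint[symmetric])
    show "pairwise disjnt (graph_components V E)"
      unfolding pairwise_def disjnt_iff using components_disjoint[OF assms] by blast
    show "finite C" if "C \<in> graph_components V E" for C
      using component_subset[OF E(1) that] E(2) by (rule finite_subset)
  qed
  finally show ?thesis using Union_components[OF E(1)] by simp
qed

lemma component_classes_disjoint_Un:
  assumes "finite V" "finite W" "E \<subseteq> V \<times> V" "F \<subseteq> W \<times> W" "V \<inter> W = {}"
  shows "component_classes (V \<union> W) (E \<union> F) = component_classes V E + component_classes W F"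
proof -
  note c = components_disjoint_Un[OF assms(3-5)]
  have "mset_set (graph_components V E \<union> graph_components W F) = mset_set (graph_components V E) + mset_set (graph_components W F)"
    using c(4) by (intro mset_set_Union finite_components assms(1,2))
  moreover have "image_mset (\<lambda>C. iso_class C ((E \<union> F) \<inter> C \<times> C)) (mset_set (graph_components V E)) = component_classes V E"
    unfolding component_classes_def using finite_components[OF assms(1)]
    by (intro image_mset_cong) (simp add: c(2))
  moreover have "image_mset (\<lambda>C. iso_class C ((E \<union> F) \<inter> C \<times> C)) (mset_set (graph_components W F)) = component_classes W F"
    unfolding component_classes_def using finite_components[OF assms(2)]
    by (intro image_mset_cong) (simp add: c(3))
  ultimately show ?thesis
    unfolding component_classes_def[of "V \<union> W"] c(1) by simp
qed

text \<open>
  A class of connected graphs, closed under isomorphism, from which larger graphs are assembled as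
  disjoint unions.
\<close>
locale connected_class =
  fixes K :: "nat set \<Rightarrow> (nat \<times> nat) set \<Rightarrow> bool"
  assumes K_loop_graph: "K V E \<Longrightarrow> loop_graph V E"
    and K_nonempty: "K V E \<Longrightarrow> V \<noteq> {}"
    and K_connected: "K V E \<Longrightarrow> u \<in> V \<Longrightarrow> v \<in> V \<Longrightarrow> (u, v) \<in> E\<^sup>*"
    and K_iso: "K V E \<Longrightarrow> graph_iso \<phi> V E W F \<Longrightarrow> K W F"
begin

definition assembled :: "nat set \<Rightarrow> (nat \<times> nat) set \<Rightarrow> bool" where
  "assembled V E \<longleftrightarrow> loop_graph V E \<and> (\<forall>C\<in>graph_components V E. K C (E \<inter> C \<times> C))"

definition classes :: "(nat \<times> (nat \<times> nat) set set) set" where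
  "classes = (\<Union>k. iso_class {..<k} ` {E. K {..<k} E})"

lemma fst_classes: "{c\<in>classes. fst c = k} = iso_class {..<k} ` {E. K {..<k} E}"
  by (auto simp: classes_def iso_class_def)

lemma iso_class_in_classes:
  assumes "K V E" shows "iso_class V E \<in> classes"
proof -
  have V: "finite V" "E \<subseteq> V \<times> V" using K_loop_graph[OF assms] by (auto simp: loop_graph_def)
  obtain \<phi> F where \<phi>: "graph_iso \<phi> V E {..<card V} F" using ex_standard_copy[OF V(1)] by blast
  have "K {..<card V} F" using K_iso[OF assms \<phi>] .
  moreover have "iso_class V E = iso_class {..<card V} F"
    using \<phi> V graph_iso_edges_subset[OF \<phi> V(2)] by (subst iso_class_eq_iff) auto
  ultimately show ?thesis by (auto simp: classes_def)
qed

sublocale weighted_colours classes fst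
proof
  fix c assume "c \<in> classes"
  then show "0 < fst c" using K_nonempty by (fastforce simp: classes_def iso_class_def)
next
  fix k
  have "{E. K {..<k} E} \<subseteq> Pow ({..<k} \<times> {..<k})"
    using K_loop_graph by (auto simp: loop_graph_def)
  then show "finite {c\<in>classes. fst c = k}"
    unfolding fst_classes by (intro finite_imageI) (auto intro: finite_subset)
qed

lemma num_colours_eq: "num_colours k = card ({E. K {..<k} E} // iso_rel k)"
  by (simp add: num_colours_def fst_classes card_quotient_iso_rel)

text \<open>
  Adding one class at a time, a copy of a representative is put on the next free vertices.
\<close>
lemma assembled_realizes:
  assumes "set_mset M \<subseteq> classes"
  shows "\<exists>E. assembled {..<\<Sum>c\<in>#M. fst c} E \<and> component_classes {..<\<Sum>c\<in>#M. fst c} E = M"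
  using assms
proof (induction M)
  case empty
  then show ?case
    by (intro exI[of _ "{}"]) (simp add: assembled_def loop_graph_def graph_components_def component_classes_def sym_def)
next
  case (add c M)
  define n where "n = (\<Sum>c\<in>#M. fst c)"
  obtain E where E: "assembled {..<n} E" "component_classes {..<n} E = M"
    using add unfolding n_def by auto
  from add obtain k G where G: "K {..<k} G" "c = iso_class {..<k} G"
    by (auto simp: classes_def)
  define W where "W = (\<lambda>i. n + i) ` {..<k}"
  define F where "F = map_prod (\<lambda>i. n + i) (\<lambda>i. n + i) ` G"
  have iso: "graph_iso (\<lambda>i. n + i) {..<k} G W F"
    by (auto simp: graph_iso_def W_def F_def bij_betw_def inj_on_def)
  have KF: "K W F" using K_iso[OF G(1) iso] .
  have fin: "finite W" "F \<subseteq> W \<times> W" "sym F"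
    using K_loop_graph[OF KF] by (auto simp: loop_graph_def)
  have En: "E \<subseteq> {..<n} \<times> {..<n}" "sym E" using E by (auto simp: assembled_def loop_graph_def)
  have G': "G \<subseteq> {..<k} \<times> {..<k}" using K_loop_graph[OF G(1)] by (auto simp: loop_graph_def)
  have disj: "{..<n} \<inter> W = {}" by (auto simp: W_def)
  have comps: "graph_components W F = {W}"
    using K_connected[OF KF] K_nonempty[OF KF] fin by (intro connected_components) auto
  have FW: "F \<inter> W \<times> W = F" using fin by auto
  have "component_classes W F = {#iso_class W F#}"
    by (simp add: component_classes_def comps FW)
  also have "iso_class W F = c"
    unfolding G(2) using iso fin G' by (subst eq_commute, subst iso_class_eq_iff) auto
  finally have cc: "component_classes ({..<n} \<union> W) (E \<union> F) = add_mset c M"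
    using component_classes_disjoint_Un[OF _ fin(1) En(1) fin(2) disj] E(2) by simp
  have "{..<n} \<union> W = {..<n + k}"
    by (auto simp: W_def lessThan_atLeast0)
  also have "n + k = (\<Sum>c\<in>#add_mset c M. fst c)"
    by (simp add: n_def G(2) iso_class_def)
  finally have VW: "{..<n} \<union> W = {..<\<Sum>c\<in>#add_mset c M. fst c}" .
  have "assembled ({..<n} \<union> W) (E \<union> F)"
    unfolding assembled_def
  proof (intro conjI ballI)
    show "loop_graph ({..<n} \<union> W) (E \<union> F)"
      using fin En by (auto simp: loop_graph_def sym_Un)
    fix C assume "C \<in> graph_components ({..<n} \<union> W) (E \<union> F)"
    then show "K C ((E \<union> F) \<inter> C \<times> C)"
      using components_disjoint_Un[OF En(1) fin(2) disj] E(1) KF FW comps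
      by (auto simp: assembled_def)
  qed
  then show ?case using cc unfolding VW by blast
qed

text \<open>
  The isomorphism class of an assembled graph is determined by the multiset of the classes of its
  components, and every multiset of classes arises.
\<close>
theorem card_assembled: "card ({E. assembled {..<n} E} // iso_rel n) = num_msets n"
proof -
  have lg: "loop_graph {..<n} E" if "assembled {..<n} E" for E
    using that by (simp add: assembled_def)
  have iff: "iso_class {..<n} E = iso_class {..<n} F \<longleftrightarrow> component_classes {..<n} E = component_classes {..<n} F"
    if "assembled {..<n} E" "assembled {..<n} F" for E F
  proof -
    have "iso_class {..<n} E = iso_class {..<n} F \<longleftrightarrow> (\<exists>\<phi>. graph_iso \<phi> {..<n} E {..<n} F)"
      using lg[OF that(1)] lg[OF that(2)] by (intro iso_class_eq_iff) (auto simp: loop_graph_def)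
    then show ?thesis
      using component_classes_iso[OF _ lg[OF that(1)]] iso_of_component_classes_eq[OF lg[OF that(1)] lg[OF that(2)]]
      by blast
  qed
  have "component_classes {..<n} ` {E. assembled {..<n} E} = weighted_msets classes fst n"
  proof (intro equalityI subsetI)
    fix M assume "M \<in> component_classes {..<n} ` {E. assembled {..<n} E}"
    then obtain E where E: "assembled {..<n} E" "M = component_classes {..<n} E" by auto
    have "finite (graph_components {..<n} E)" by (simp add: finite_components)
    then have "set_mset M \<subseteq> classes"
      using E iso_class_in_classes by (auto simp: component_classes_def assembled_def)
    then show "M \<in> weighted_msets classes fst n"
      using component_classes_weight[OF lg[OF E(1)]] E(2) by (simp add: weighted_msets_def)
  next
    fix M assume "M \<in> weighted_msets classes fst n"
    then show "M \<in> component_classes {..<n} ` {E. assembled {..<n} E}"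
      using assembled_realizes[of M] by (fastforce simp: weighted_msets_def)
  qed
  moreover have "finite {E. assembled {..<n} E}"
  proof (rule finite_subset)
    show "{E. assembled {..<n} E} \<subseteq> Pow ({..<n} \<times> {..<n})"
      using lg unfolding loop_graph_def by blast
  qed simp
  then have "card (iso_class {..<n} ` {E. assembled {..<n} E}) = card (component_classes {..<n} ` {E. assembled {..<n} E})"
    by (rule card_image_eq_of_kernel) (simp only: mem_Collect_eq iff)
  ultimately show ?thesis by (simp add: card_quotient_iso_rel num_msets_def)
qed

end

section \<open>Forests as multisets of trees\<close>

text \<open>
  An edge is a bridge if its ends are no longer joined once the edge is removed. This expresses
  the absence of cycles in terms of reachability only.
\<close>
definition all_bridges :: "('a \<times> 'a) set \<Rightarrow> bool" where
  "all_bridges E \<longleftrightarrow> (\<forall>u v. (u, v) \<in> E \<longrightarrow> (u, v) \<notin> (E - {(u, v), (v, u)})\<^sup>*)"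

lemma all_bridgesD: "all_bridges E \<Longrightarrow> (u, v) \<in> E \<Longrightarrow> (u, v) \<in> (E - {(u, v), (v, u)})\<^sup>* \<Longrightarrow> False"
  by (auto simp: all_bridges_def)

lemma all_bridges_mono: "all_bridges F \<Longrightarrow> E \<subseteq> F \<Longrightarrow> all_bridges E"
  unfolding all_bridges_def by (meson Diff_mono order_refl rtrancl_mono subsetD)

text \<open>
  A walk can be shortened to one without repeated vertices by cutting out the part between two visits.
\<close>
lemma rtrancl_imp_simple_path:
  assumes "(u, v) \<in> R\<^sup>*"
  shows "\<exists>ps. ps \<noteq> [] \<and> distinct ps \<and> hd ps = u \<and> last ps = v \<and> successively (\<lambda>x y. (x, y) \<in> R) ps"
  using assms
proof (induction rule: converse_rtrancl_induct)
  case base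
  show ?case by (intro exI[of _ "[v]"]) simp
next
  case (step u y)
  then obtain ps where ps: "ps \<noteq> []" "distinct ps" "hd ps = y" "last ps = v"
    "successively (\<lambda>x y. (x, y) \<in> R) ps" by blast
  show ?case
  proof (cases "u \<in> set ps")
    case True
    then obtain as bs where "ps = as @ u # bs" by (meson split_list)
    then show ?thesis using ps
      by (intro exI[of _ "u # bs"]) (auto simp: successively_append_iff)
  next
    case False
    then show ?thesis using ps step(1)
      by (intro exI[of _ "u # ps"]) (auto simp: successively_Cons)
  qed
qed

lemma cycle_imp_not_bridge:
  assumes "is_cycle E xs" "sym E" shows "\<not> all_bridges E"
proof
  assume br: "all_bridges E"
  define m where "m = length xs"
  have m: "3 \<le> m" "distinct xs" and edge: "\<And>i. i < m \<Longrightarrow> (xs ! i, xs ! (Suc i mod m)) \<in> E"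
    using assms(1) by (auto simp: is_cycle_def m_def)
  \<comment> \<open>the rest of the cycle connects the ends of its first edge\<close>
  define R where "R = E - {(xs ! 1, xs ! 0), (xs ! 0, xs ! 1)}"
  have neq: "xs ! i \<noteq> xs ! j" if "i < m" "j < m" "i \<noteq> j" for i j
    using m that by (simp add: m_def nth_eq_iff_index_eq)
  have path: "(xs ! 1, xs ! Suc i) \<in> R\<^sup>*" if "Suc i < m" for i
    using that
  proof (induction i)
    case (Suc i)
    have "(xs ! Suc i, xs ! Suc (Suc i)) \<in> E" using edge[of "Suc i"] Suc.prems by simp
    moreover have "xs ! Suc i \<noteq> xs ! 0" "xs ! Suc (Suc i) \<noteq> xs ! 0"
      using neq[of "Suc i" 0] neq[of "Suc (Suc i)" 0] Suc.prems by auto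
    ultimately have "(xs ! Suc i, xs ! Suc (Suc i)) \<in> R" by (auto simp: R_def)
    with Suc show ?case by (auto intro: rtrancl_into_rtrancl)
  qed simp
  have "(xs ! (m - 1), xs ! 0) \<in> E" using edge[of "m - 1"] m by simp
  moreover have "xs ! (m - 1) \<noteq> xs ! 0" "xs ! (m - 1) \<noteq> xs ! 1"
    using neq[of "m - 1" 0] neq[of "m - 1" 1] m by auto
  ultimately have "(xs ! (m - 1), xs ! 0) \<in> R" by (auto simp: R_def)
  moreover have "(xs ! 1, xs ! (m - 1)) \<in> R\<^sup>*" using path[of "m - 2"] m by (simp add: Suc_diff_Suc numeral_2_eq_2)
  ultimately have "(xs ! 1, xs ! 0) \<in> R\<^sup>*" by (rule rtrancl_into_rtrancl[rotated])
  moreover have "(xs ! 1, xs ! 0) \<in> E" using edge[of 0] m assms(2) by (auto dest: symD)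
  ultimately show False using all_bridgesD[OF br] by (simp add: R_def)
qed

text \<open>
  If an edge is not a bridge, a simple path between its ends that avoids it is closed by it to a
  cycle. The path has at least three vertices because it avoids the edge in both directions.
\<close>
lemma not_bridge_imp_cycle:
  assumes "\<not> all_bridges E" "sym E" "irrefl E" shows "\<exists>xs. is_cycle E xs"
proof -
  obtain u v where uv: "(u, v) \<in> E" "(u, v) \<in> (E - {(u, v), (v, u)})\<^sup>*"
    using assms(1) by (auto simp: all_bridges_def)
  obtain ps where ps: "ps \<noteq> []" "distinct ps" "hd ps = u" "last ps = v"
    and suc: "successively (\<lambda>x y. (x, y) \<in> E - {(u, v), (v, u)}) ps"
    using rtrancl_imp_simple_path[OF uv(2)] by blast
  have "u \<noteq> v" using uv(1) assms(3) by (auto simp: irrefl_def)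
  have consec: "(ps ! i, ps ! Suc i) \<in> E - {(u, v), (v, u)}" if "Suc i < length ps" for i
    using suc that by (simp add: successively_conv_nth)
  have ends: "ps ! 0 = u" "ps ! (length ps - 1) = v"
    using ps by (auto simp: hd_conv_nth last_conv_nth)
  have "length ps \<noteq> 0" "length ps \<noteq> 1" using ps ends \<open>u \<noteq> v\<close> by auto
  moreover have "length ps \<noteq> 2" using consec[of 0] ends by auto
  ultimately have len: "3 \<le> length ps" by linarith
  have "(ps ! i, ps ! (Suc i mod length ps)) \<in> E" if "i < length ps" for i
  proof (cases "Suc i < length ps")
    case True then show ?thesis using consec[OF True] by simp
  next
    case False
    then have i: "Suc i = length ps" using that by linarith
    then have "ps ! i = v" using ends(2) by (metis diff_Suc_1)
    then show ?thesis using i ends(1) symD[OF assms(2) uv(1)] by simp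
  qed
  then show ?thesis using len ps(2) by (auto simp: is_cycle_def)
qed

lemma forest_iff: "forest V E \<longleftrightarrow> loop_graph V E \<and> irrefl E \<and> all_bridges E"
  unfolding forest_def simple_graph_def loop_graph_def
  using cycle_imp_not_bridge not_bridge_imp_cycle by blast

lemma tree_iff:
  "tree V E \<longleftrightarrow> loop_graph V E \<and> irrefl E \<and> all_bridges E \<and> V \<noteq> {} \<and> (\<forall>u\<in>V. \<forall>v\<in>V. (u, v) \<in> E\<^sup>*)"
  by (auto simp: tree_def forest_iff)

lemma tree_iso:
  assumes "tree V E" "graph_iso \<phi> V E W F" shows "tree W F"
proof -
  have t: "loop_graph V E" "irrefl E" "all_bridges E" "V \<noteq> {}" "\<And>u v. u \<in> V \<Longrightarrow> v \<in> V \<Longrightarrow> (u, v) \<in> E\<^sup>*"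
    using assms(1) by (auto simp: tree_iff)
  have E: "E \<subseteq> V \<times> V" using t(1) by (simp add: loop_graph_def)
  have F: "F \<subseteq> W \<times> W" using graph_iso_edges_subset[OF assms(2) E] .
  define \<psi> where "\<psi> = inv_into V \<phi>"
  have \<psi>: "graph_iso \<psi> W F V E" unfolding \<psi>_def by (rule graph_iso_inv[OF assms(2) E])
  have mem: "(\<psi> a, \<psi> b) \<in> E" if "(a, b) \<in> F" for a b
    using \<psi> that unfolding graph_iso_def by (metis map_prod_imageI)
  have inj: "inj_on \<psi> W" using \<psi> by (simp add: graph_iso_def bij_betw_def)
  have "irrefl F" unfolding irrefl_def
    using mem t(2) unfolding irrefl_def by blast
  moreover have "all_bridges F"
    unfolding all_bridges_def
  proof (intro allI impI notI)
    fix a b assume ab: "(a, b) \<in> F" "(a, b) \<in> (F - {(a, b), (b, a)})\<^sup>*"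
    have "map_prod \<psi> \<psi> ` (F - {(a, b), (b, a)}) = map_prod \<psi> \<psi> ` F - map_prod \<psi> \<psi> ` {(a, b), (b, a)}"
      using F ab(1) map_prod_inj_on[OF inj inj] by (intro inj_on_image_set_diff[where C = "W \<times> W"]) auto
    then have "graph_iso \<psi> W (F - {(a, b), (b, a)}) V (E - {(\<psi> a, \<psi> b), (\<psi> b, \<psi> a)})"
      using \<psi> by (simp add: graph_iso_def)
    from all_bridgesD[OF t(3) mem[OF ab(1)] graph_iso_rtrancl[OF this ab(2)]] show False .
  qed
  moreover have "W \<noteq> {}" using t(4) assms(2) by (auto simp: graph_iso_def bij_betw_def)
  moreover have "(a, b) \<in> F\<^sup>*" if "a \<in> W" "b \<in> W" for a b
    using that graph_iso_rtrancl_iff[OF \<psi> F that] t(5)[of "\<psi> a" "\<psi> b"] \<psi>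
    by (auto simp: graph_iso_def bij_betw_def)
  ultimately show ?thesis using graph_iso_loop_graph[OF assms(2) t(1)] by (auto simp: tree_iff)
qed

interpretation trees: connected_class tree
proof
  show "tree W F" if "tree V E" "graph_iso \<phi> V E W F" for V W :: "nat set" and E F \<phi>
    using that by (rule tree_iso)
qed (auto simp: tree_iff)

text \<open>
  Reachability by edges of one component stays inside this component, so the property that an edge is
  a bridge can be tested in its component.
\<close>
lemma assembled_trees: "trees.assembled V E \<longleftrightarrow> forest V E"
proof
  assume asm: "trees.assembled V E"
  then have V: "loop_graph V E" and t: "\<And>C. C \<in> graph_components V E \<Longrightarrow> tree C (E \<inter> C \<times> C)"
    by (auto simp: trees.assembled_def)
  have comp: "\<exists>C\<in>graph_components V E. u \<in> C \<and> v \<in> C" if "(u, v) \<in> E" for u v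
    using that edges_Union_components[OF V] by blast
  have "irrefl E"
  proof (rule irreflI)
    fix u show "(u, u) \<notin> E"
      using comp[of u u] t unfolding tree_iff irrefl_def by blast
  qed
  moreover have "all_bridges E"
    unfolding all_bridges_def
  proof (intro allI impI notI)
    fix u v assume uv: "(u, v) \<in> E" "(u, v) \<in> (E - {(u, v), (v, u)})\<^sup>*"
    obtain C where C: "C \<in> graph_components V E" "u \<in> C" "v \<in> C" using comp[OF uv(1)] by blast
    let ?R = "E - {(u, v), (v, u)}"
    have "(u, v) \<in> (?R \<inter> C \<times> C)\<^sup>*"
      using closed_set_rtrancl[of C ?R u v] uv(2) C(2) component_closed[OF V C(1)] by blast
    moreover have "?R \<inter> C \<times> C = E \<inter> C \<times> C - {(u, v), (v, u)}" by blast
    ultimately show False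
      using all_bridgesD[of "E \<inter> C \<times> C" u v] t[OF C(1)] uv(1) C by (auto simp: tree_iff)
  qed
  ultimately show "forest V E" using V by (simp add: forest_iff)
next
  assume "forest V E"
  then have V: "loop_graph V E" "irrefl E" "all_bridges E" by (auto simp: forest_iff)
  have "tree C (E \<inter> C \<times> C)" if C: "C \<in> graph_components V E" for C
    unfolding tree_iff
  proof (intro conjI ballI)
    have "C \<subseteq> V" using V(1) component_subset[OF _ C] by (simp add: loop_graph_def)
    then show "loop_graph C (E \<inter> C \<times> C)"
      using V(1) by (auto simp: loop_graph_def sym_def intro: finite_subset)
    show "irrefl (E \<inter> C \<times> C)" using V(2) by (auto simp: irrefl_def)
    show "all_bridges (E \<inter> C \<times> C)" using V(3) by (rule all_bridges_mono) simp
    show "C \<noteq> {}" using component_nonempty[OF C] .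
    show "(u, v) \<in> (E \<inter> C \<times> C)\<^sup>*" if "u \<in> C" "v \<in> C" for u v
      using component_connected[OF V(1) C that] .
  qed
  then show "trees.assembled V E" using V(1) by (simp add: trees.assembled_def)
qed

lemma num_trees_eq: "num_trees k = trees.num_colours k"
  by (simp add: num_trees_def trees.num_colours_eq)

lemma num_forests_eq: "num_forests n = trees.num_msets n"
  using trees.card_assembled[of n] by (simp add: num_forests_def assembled_trees)

text \<open>
  A loop stands for the root, so that an isomorphism of graphs automatically preserves the root.
\<close>
definition looped_tree :: "'a set \<Rightarrow> ('a \<times> 'a) set \<Rightarrow> bool" where
  "looped_tree V E \<longleftrightarrow> (\<exists>x\<in>V. \<exists>T. tree V T \<and> E = insert (x, x) T)"

lemma tree_edges: "tree V E \<Longrightarrow> E \<subseteq> V \<times> V" "tree V E \<Longrightarrow> (v, v) \<notin> E"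
  by (auto simp: tree_iff loop_graph_def irrefl_def)

lemma graph_iso_insert_loop:
  assumes "graph_iso \<phi> V E W F"
  shows "graph_iso \<phi> V (insert (x, x) E) W (insert (\<phi> x, \<phi> x) F)"
  using assms by (auto simp: graph_iso_def)

lemma graph_iso_insert_loopD:
  assumes iso: "graph_iso \<phi> V (insert (x, x) E) W (insert (y, y) F)"
    and E: "irrefl E" "E \<subseteq> V \<times> V" and F: "irrefl F" and x: "x \<in> V"
  shows "graph_iso \<phi> V E W F \<and> \<phi> x = y"
proof -
  have inj: "inj_on \<phi> V" and img: "insert (\<phi> x, \<phi> x) (map_prod \<phi> \<phi> ` E) = insert (y, y) F"
    using iso by (auto simp: graph_iso_def bij_betw_def)
  have "(\<phi> x, \<phi> x) \<in> insert (y, y) F" using img by blast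
  then have y: "\<phi> x = y" using F by (auto simp: irrefl_def)
  have "(y, y) \<notin> map_prod \<phi> \<phi> ` E"
  proof
    assume "(y, y) \<in> map_prod \<phi> \<phi> ` E"
    then obtain u v where "(u, v) \<in> E" "\<phi> u = y" "\<phi> v = y" by auto
    moreover from this have "u = v" using inj E(2) by (auto dest!: inj_onD)
    ultimately show False using E(1) by (auto simp: irrefl_def)
  qed
  moreover have "(y, y) \<notin> F" using F by (auto simp: irrefl_def)
  ultimately have "map_prod \<phi> \<phi> ` E = F" using img unfolding y by (simp add: insert_ident)
  then show ?thesis using iso y by (simp add: graph_iso_def)
qed

lemma rtrancl_insert_loop: "(insert (x, x) T)\<^sup>* = T\<^sup>*"
proof -
  have "(insert (x, x) T)\<^sup>* = (insert (x, x) T - Id)\<^sup>*" by (rule rtrancl_r_diff_Id[symmetric])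
  also have "insert (x, x) T - Id = T - Id" by auto
  finally show ?thesis by (simp add: rtrancl_r_diff_Id)
qed

interpretation rooted: connected_class looped_tree
proof
  fix V :: "nat set" and E assume "looped_tree V E"
  then obtain x T where x: "x \<in> V" "tree V T" "E = insert (x, x) T" by (auto simp: looped_tree_def)
  show "loop_graph V E" using x by (auto simp: tree_iff loop_graph_def sym_def)
  show "V \<noteq> {}" using x by auto
  show "(u, v) \<in> E\<^sup>*" if "u \<in> V" "v \<in> V" for u v
    using x that by (simp add: rtrancl_insert_loop tree_iff)
  show "looped_tree W F" if iso: "graph_iso \<phi> V E W F" for \<phi> W F
  proof -
    define S where "S = map_prod \<phi> \<phi> ` T"
    have "graph_iso \<phi> V T W S" using iso by (simp add: graph_iso_def S_def)
    moreover have "F = insert (\<phi> x, \<phi> x) S" using iso x(3) by (simp add: graph_iso_def S_def)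
    moreover have "\<phi> x \<in> W" using iso x(1) by (auto simp: graph_iso_def bij_betw_def)
    ultimately show ?thesis using tree_iso[OF x(2)] unfolding looped_tree_def by blast
  qed
qed

lemma finite_trees: "finite {E. tree {..<n::nat} E}"
proof -
  have "{E. tree {..<n} E} \<subseteq> Pow ({..<n} \<times> {..<n})" using tree_edges(1) by blast
  then show ?thesis by (rule finite_subset) simp
qed

lemma finite_rooted_trees: "finite {(E, x). tree {..<n::nat} E \<and> x < n}"
proof -
  have "{(E, x). tree {..<n} E \<and> x < n} = {E. tree {..<n} E} \<times> {..<n}" by auto
  then show ?thesis using finite_trees by simp
qed

lemma iso_rel_class_eq_iff:
  assumes "E \<subseteq> {..<n} \<times> {..<n}" "F \<subseteq> {..<n} \<times> {..<n}"
  shows "iso_rel n `` {E} = iso_rel n `` {F} \<longleftrightarrow> (\<exists>\<phi>. graph_iso \<phi> {..<n} E {..<n} F)"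
  using iso_class_eq_iff[of "{..<n}" "{..<n}" E F] assms by (simp add: iso_class_lessThan)

lemma rooted_iso_rel_class_eq_iff:
  assumes "E \<subseteq> {..<n} \<times> {..<n}" "F \<subseteq> {..<n} \<times> {..<n}" "x < n" "y < n"
  shows "rooted_iso_rel n `` {(E, x)} = rooted_iso_rel n `` {(F, y)} \<longleftrightarrow>
    (\<exists>\<phi>. graph_iso \<phi> {..<n} E {..<n} F \<and> \<phi> x = y)"
proof
  assume eq: "rooted_iso_rel n `` {(E, x)} = rooted_iso_rel n `` {(F, y)}"
  have "(F, y) \<in> rooted_iso_rel n `` {(F, y)}"
    using graph_iso_refl[of "{..<n}" F] by (auto simp: rooted_iso_rel_def intro!: exI[of _ id])
  then show "\<exists>\<phi>. graph_iso \<phi> {..<n} E {..<n} F \<and> \<phi> x = y"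
    unfolding eq[symmetric] by (auto simp: rooted_iso_rel_def)
next
  assume "\<exists>\<phi>. graph_iso \<phi> {..<n} E {..<n} F \<and> \<phi> x = y"
  then obtain \<phi> where \<phi>: "graph_iso \<phi> {..<n} E {..<n} F" "\<phi> x = y" by blast
  let ?\<phi>' = "inv_into {..<n} \<phi>"
  have \<phi>': "graph_iso ?\<phi>' {..<n} F {..<n} E" by (rule graph_iso_inv[OF \<phi>(1) assms(1)])
  have "inj_on \<phi> {..<n}" using \<phi>(1) by (simp add: graph_iso_def bij_betw_def)
  then have x: "?\<phi>' y = x" using assms(3) \<phi>(2) by auto
  have "\<exists>\<psi>. graph_iso \<psi> {..<n} F {..<n} G \<and> \<psi> y = z" if "graph_iso \<psi> {..<n} E {..<n} G" "\<psi> x = z" for \<psi> G z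
    using graph_iso_trans[OF \<phi>' that(1)] x that(2) by (intro exI[of _ "\<psi> \<circ> ?\<phi>'"]) simp
  moreover have "\<exists>\<psi>. graph_iso \<psi> {..<n} E {..<n} G \<and> \<psi> x = z" if "graph_iso \<psi> {..<n} F {..<n} G" "\<psi> y = z" for \<psi> G z
    using graph_iso_trans[OF \<phi>(1) that(1)] \<phi>(2) that(2) by (intro exI[of _ "\<psi> \<circ> \<phi>"]) simp
  ultimately show "rooted_iso_rel n `` {(E, x)} = rooted_iso_rel n `` {(F, y)}"
    by (auto simp: rooted_iso_rel_def)
qed

lemma num_rooted_trees_eq: "num_rooted_trees k = rooted.num_colours k"
proof -
  let ?A = "{(E, x). tree {..<k} E \<and> x < k}"
  have "card ((\<lambda>p. rooted_iso_rel k `` {p}) ` ?A) = card ((\<lambda>(E, x). iso_rel k `` {insert (x, x) E}) ` ?A)"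
  proof (rule card_image_eq_of_kernel[OF finite_rooted_trees])
    fix p q assume "p \<in> ?A" "q \<in> ?A"
    then obtain E x F y where p: "p = (E, x)" "tree {..<k} E" "x < k" and q: "q = (F, y)" "tree {..<k} F" "y < k"
      by auto
    note e = tree_edges[OF p(2)] tree_edges[OF q(2)]
    have irr: "irrefl E" "irrefl F" using p(2) q(2) by (auto simp: tree_iff)
    have "(\<exists>\<phi>. graph_iso \<phi> {..<k} E {..<k} F \<and> \<phi> x = y) \<longleftrightarrow>
        (\<exists>\<phi>. graph_iso \<phi> {..<k} (insert (x, x) E) {..<k} (insert (y, y) F))"
      using graph_iso_insert_loop[of _ "{..<k}" E "{..<k}" F x]
        graph_iso_insert_loopD[OF _ irr(1) e(1) irr(2), of _ x "{..<k}" y] p(3) by blast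
    then show "(rooted_iso_rel k `` {p} = rooted_iso_rel k `` {q}) \<longleftrightarrow>
        ((case p of (E, x) \<Rightarrow> iso_rel k `` {insert (x, x) E}) = (case q of (E, x) \<Rightarrow> iso_rel k `` {insert (x, x) E}))"
      using e p q by (simp add: rooted_iso_rel_class_eq_iff iso_rel_class_eq_iff)
  qed
  moreover have "(\<lambda>p. rooted_iso_rel k `` {p}) ` ?A = ?A // rooted_iso_rel k"
    by (rule quotient_eq_image[symmetric])
  moreover have "(\<lambda>(E, x). iso_rel k `` {insert (x, x) E}) ` ?A = {E. looped_tree {..<k} E} // iso_rel k"
  proof -
    have "{E. looped_tree {..<k} E} = (\<lambda>(E, x). insert (x, x) E) ` ?A"
      by (auto simp: looped_tree_def image_iff)
    then show ?thesis by (simp add: quotient_def image_image case_prod_unfold UNION_singleton_eq_range)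
  qed
  ultimately show ?thesis by (simp add: num_rooted_trees_def rooted.num_colours_eq)
qed

text \<open>
  Joins a new vertex \<open>z\<close> to the roots of all components and removes the loops that marked these roots.
\<close>
definition add_apex :: "'a \<Rightarrow> ('a \<times> 'a) set \<Rightarrow> ('a \<times> 'a) set" where
  "add_apex z E = {(u, v). (u, v) \<in> E \<and> u \<noteq> v \<or> u = z \<and> (v, v) \<in> E \<or> v = z \<and> (u, u) \<in> E}"

text \<open>
  The inverse operation: the neighbours of the deleted vertex become the marked roots.
\<close>
definition del_apex :: "'a \<Rightarrow> ('a \<times> 'a) set \<Rightarrow> ('a \<times> 'a) set" where
  "del_apex z T = {(u, v). u \<noteq> z \<and> v \<noteq> z \<and> (u, v) \<in> T \<or> u = v \<and> (z, u) \<in> T}"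

lemma del_add_apex: "E \<subseteq> V \<times> V \<Longrightarrow> z \<notin> V \<Longrightarrow> del_apex z (add_apex z E) = E"
  by (auto simp: add_apex_def del_apex_def)

lemma add_del_apex: "sym T \<Longrightarrow> irrefl T \<Longrightarrow> add_apex z (del_apex z T) = T"
  by (auto simp: add_apex_def del_apex_def irrefl_def dest: symD)

lemma graph_iso_mem_iff:
  assumes "graph_iso \<phi> V E W F" "E \<subseteq> V \<times> V" "u \<in> V" "v \<in> V"
  shows "(\<phi> u, \<phi> v) \<in> F \<longleftrightarrow> (u, v) \<in> E"
proof
  assume "(\<phi> u, \<phi> v) \<in> F"
  then obtain u' v' where "(u', v') \<in> E" "\<phi> u = \<phi> u'" "\<phi> v = \<phi> v'"
    using assms(1) by (auto simp: graph_iso_def)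
  moreover have "inj_on \<phi> V" using assms(1) by (simp add: graph_iso_def bij_betw_def)
  ultimately show "(u, v) \<in> E" using assms by (metis SigmaE2 inj_onD subsetD)
qed (use assms in \<open>force simp: graph_iso_def\<close>)

lemma graph_isoI:
  assumes "bij_betw \<phi> V W" "E \<subseteq> V \<times> V" "F \<subseteq> W \<times> W"
    and "\<And>u v. u \<in> V \<Longrightarrow> v \<in> V \<Longrightarrow> (\<phi> u, \<phi> v) \<in> F \<longleftrightarrow> (u, v) \<in> E"
  shows "graph_iso \<phi> V E W F"
proof -
  have "map_prod \<phi> \<phi> ` E = F"
  proof (intro equalityI subrelI)
    fix a b assume ab: "(a, b) \<in> F"
    then obtain u v where "u \<in> V" "v \<in> V" "a = \<phi> u" "b = \<phi> v"
      using assms(1,3) by (auto simp: bij_betw_def)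
    then show "(a, b) \<in> map_prod \<phi> \<phi> ` E"
      using ab assms(4)[of u v] by (intro image_eqI[of _ _ "(u, v)"]) auto
  qed (use assms(2,4) in auto)
  then show ?thesis using assms(1) by (simp add: graph_iso_def)
qed

lemma add_apex_edges: "E \<subseteq> V \<times> V \<Longrightarrow> add_apex z E \<subseteq> insert z V \<times> insert z V"
  by (auto simp: add_apex_def)

lemma del_apex_edges: "T \<subseteq> insert z V \<times> insert z V \<Longrightarrow> irrefl T \<Longrightarrow> del_apex z T \<subseteq> V \<times> V"
  by (auto simp: del_apex_def irrefl_def)

lemma graph_iso_add_apex:
  assumes "graph_iso \<phi> V E W F" "E \<subseteq> V \<times> V" "z \<notin> V" "z \<notin> W"
  shows "graph_iso (\<phi>(z := z)) (insert z V) (add_apex z E) (insert z W) (add_apex z F)"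
proof (rule graph_isoI)
  have F: "F \<subseteq> W \<times> W" using graph_iso_edges_subset[OF assms(1,2)] .
  have bij: "bij_betw \<phi> V W" using assms(1) by (simp add: graph_iso_def)
  show "add_apex z E \<subseteq> insert z V \<times> insert z V" "add_apex z F \<subseteq> insert z W \<times> insert z W"
    by (rule add_apex_edges[OF assms(2)], rule add_apex_edges[OF F])
  have "bij_betw (\<phi>(z := z)) V W" using bij assms(3) by (subst bij_betw_cong[where g = \<phi>]) auto
  then show "bij_betw (\<phi>(z := z)) (insert z V) (insert z W)"
    using assms(3,4) notIn_Un_bij_betw[of z V "\<phi>(z := z)" W] by simp
  fix u v assume uv: "u \<in> insert z V" "v \<in> insert z V"
  have m: "(\<phi> a, \<phi> b) \<in> F \<longleftrightarrow> (a, b) \<in> E" if "a \<in> V" "b \<in> V" for a b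
    using graph_iso_mem_iff[OF assms(1,2) that] .
  have W: "\<phi> a \<noteq> z" if "a \<in> V" for a using that bij assms(4) by (auto simp: bij_betw_def)
  have i: "\<phi> a = \<phi> b \<longleftrightarrow> a = b" if "a \<in> V" "b \<in> V" for a b
    using that bij by (auto simp: bij_betw_def dest: inj_onD)
  have zE: "(z, a) \<notin> E" "(a, z) \<notin> E" "(z, a) \<notin> F" "(a, z) \<notin> F" for a using assms F by auto
  show "((\<phi>(z := z)) u, (\<phi>(z := z)) v) \<in> add_apex z F \<longleftrightarrow> (u, v) \<in> add_apex z E"
    using uv assms(3) by (cases "u = z"; cases "v = z") (simp_all add: add_apex_def m W i zE)
qed

lemma graph_iso_del_apex:
  assumes "graph_iso \<phi> (insert z V) T (insert z W) S" "T \<subseteq> insert z V \<times> insert z V"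
    "irrefl T" "irrefl S" "z \<notin> V" "z \<notin> W" "\<phi> z = z"
  shows "graph_iso \<phi> V (del_apex z T) W (del_apex z S)"
proof (rule graph_isoI)
  have S: "S \<subseteq> insert z W \<times> insert z W" using graph_iso_edges_subset[OF assms(1,2)] .
  have bij: "bij_betw \<phi> (insert z V) (insert z W)" using assms(1) by (simp add: graph_iso_def)
  show "del_apex z T \<subseteq> V \<times> V" by (rule del_apex_edges[OF assms(2,3)])
  show "del_apex z S \<subseteq> W \<times> W" by (rule del_apex_edges[OF S assms(4)])
  show "bij_betw \<phi> V W"
    using bij assms(5-7) notIn_Un_bij_betw3[of z V \<phi> W] by simp
  fix u v assume uv: "u \<in> V" "v \<in> V"
  have m: "(\<phi> a, \<phi> b) \<in> S \<longleftrightarrow> (a, b) \<in> T" if "a \<in> insert z V" "b \<in> insert z V" for a b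
    using graph_iso_mem_iff[OF assms(1,2) that] .
  have i: "\<phi> a = \<phi> b \<longleftrightarrow> a = b" if "a \<in> insert z V" "b \<in> insert z V" for a b
    using that bij unfolding bij_betw_def by (meson inj_on_eq_iff)
  have "u \<noteq> z" "v \<noteq> z" using uv assms(5) by auto
  then show "(\<phi> u, \<phi> v) \<in> del_apex z S \<longleftrightarrow> (u, v) \<in> del_apex z T"
    using uv m[of u v] m[of z u] i[of u v] i[of u z] i[of v z] assms(7) by (simp add: del_apex_def)
qed

text \<open>
  Every vertex reaches the apex through the root of its component. For an edge of a component \<open>C\<close>, the map that sends all
  vertices outside \<open>C\<close> to the root of \<open>C\<close> retracts a walk between the ends of the edge to a walk inside the
  tree \<open>C\<close>, where the edge is a bridge. An edge at the apex is a bridge because it is the only edge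
  between its component and the rest.
\<close>
lemma tree_add_apex:
  assumes asm: "rooted.assembled V E" and z: "z \<notin> V"
  shows "tree (insert z V) (add_apex z E)"
proof -
  have V: "loop_graph V E" and looped: "\<And>C. C \<in> graph_components V E \<Longrightarrow> looped_tree C (E \<inter> C \<times> C)"
    using asm by (auto simp: rooted.assembled_def)
  have E: "E \<subseteq> V \<times> V" "sym E" "finite V" using V by (auto simp: loop_graph_def)
  have "\<exists>r. r \<in> C \<and> (\<forall>x\<in>C. (x, x) \<in> E \<longleftrightarrow> x = r) \<and> tree C (E \<inter> C \<times> C - Id)"
    if C: "C \<in> graph_components V E" for C
  proof -
    obtain r T where r: "r \<in> C" "tree C T" "E \<inter> C \<times> C = insert (r, r) T"
      using looped[OF C] by (auto simp: looped_tree_def)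
    have T: "E \<inter> C \<times> C - Id = T" unfolding r(3) using tree_edges(2)[OF r(2)] by auto
    have "(x, x) \<in> E \<longleftrightarrow> x = r" if "x \<in> C" for x
    proof -
      have "(x, x) \<in> E \<longleftrightarrow> (x, x) \<in> E \<inter> C \<times> C" using that by simp
      then show ?thesis unfolding r(3) using tree_edges(2)[OF r(2)] by auto
    qed
    then show ?thesis using r T by (intro exI[of _ r]) simp
  qed
  then obtain root where root: "\<And>C. C \<in> graph_components V E \<Longrightarrow> root C \<in> C"
    "\<And>C x. C \<in> graph_components V E \<Longrightarrow> x \<in> C \<Longrightarrow> (x, x) \<in> E \<longleftrightarrow> x = root C"
    "\<And>C. C \<in> graph_components V E \<Longrightarrow> tree C (E \<inter> C \<times> C - Id)" by metis
  have comp: "\<exists>C\<in>graph_components V E. v \<in> C" if "v \<in> V" for v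
    using that Union_components[OF E(1)] by blast
  have sub: "C \<subseteq> V" if "C \<in> graph_components V E" for C
    using component_subset[OF E(1) that] .
  have closed: "y \<in> C \<longleftrightarrow> x \<in> C" if "C \<in> graph_components V E" "(x, y) \<in> E" for C x y
    using component_closed[OF V that(1)] that(2) symD[OF E(2) that(2)] by blast
  have lg: "loop_graph (insert z V) (add_apex z E)"
    using E add_apex_edges[OF E(1)] by (auto simp: loop_graph_def add_apex_def sym_def)
  have irr: "irrefl (add_apex z E)" using E(1) z by (auto simp: irrefl_def add_apex_def)
  have to_z: "(v, z) \<in> (add_apex z E)\<^sup>*" if "v \<in> insert z V" for v
  proof (cases "v = z")
    case False
    then obtain C where C: "C \<in> graph_components V E" "v \<in> C" using comp \<open>v \<in> insert z V\<close> by auto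
    have "(v, root C) \<in> (E \<inter> C \<times> C - Id)\<^sup>*"
      using root(3)[OF C(1)] root(1)[OF C(1)] C(2) by (simp add: tree_iff)
    moreover have "E \<inter> C \<times> C - Id \<subseteq> add_apex z E" by (auto simp: add_apex_def)
    ultimately have "(v, root C) \<in> (add_apex z E)\<^sup>*" by (meson rtrancl_mono subsetD)
    moreover have "(root C, z) \<in> add_apex z E" using root(1,2)[OF C(1)] by (simp add: add_apex_def)
    ultimately show ?thesis by (rule rtrancl_into_rtrancl)
  qed simp
  have conn: "(u, v) \<in> (add_apex z E)\<^sup>*" if "u \<in> insert z V" "v \<in> insert z V" for u v
    using to_z[OF that(1)] loop_graph_rtrancl_sym[OF lg to_z[OF that(2)]] by (rule rtrancl_trans)
  have "all_bridges (add_apex z E)"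
    unfolding all_bridges_def
  proof (intro allI impI notI)
    fix a b assume ab: "(a, b) \<in> add_apex z E" and path: "(a, b) \<in> (add_apex z E - {(a, b), (b, a)})\<^sup>*"
    define R where "R = add_apex z E - {(a, b), (b, a)}"
    consider "(a, b) \<in> E" "a \<noteq> b" | "a = z" "(b, b) \<in> E" | "b = z" "(a, a) \<in> E"
      using ab by (auto simp: add_apex_def)
    then show False
    proof cases
      case 1
      then obtain C where C: "C \<in> graph_components V E" "a \<in> C" using comp E(1) by blast
      have b: "b \<in> C" using closed[OF C(1) 1(1)] C(2) by simp
      define T where "T = E \<inter> C \<times> C - Id"
      \<comment> \<open>the retraction onto the component of the edge\<close>
      define p where "p w = (if w \<in> C then w else root C)" for w
      have zC: "z \<notin> C" using sub[OF C(1)] z by auto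
      have step: "(p x, p y) \<in> (T - {(a, b), (b, a)})\<^sup>*" if "(x, y) \<in> R" for x y
      proof -
        from that consider "(x, y) \<in> E" "x \<noteq> y" "(x, y) \<notin> {(a, b), (b, a)}" | "x = z" "(y, y) \<in> E" | "y = z" "(x, x) \<in> E"
          by (auto simp: R_def add_apex_def)
        then show ?thesis
        proof cases
          case 1
          show ?thesis
          proof (cases "x \<in> C")
            case True
            then have "(x, y) \<in> T - {(a, b), (b, a)}" "y \<in> C" using 1 closed[OF C(1) 1(1)] by (auto simp: T_def)
            then show ?thesis using True by (auto simp: p_def)
          next
            case False
            then show ?thesis using closed[OF C(1) 1(1)] by (simp add: p_def)
          qed
        qed (use root(2)[OF C(1)] zC in \<open>auto simp: p_def\<close>)
      qed
      have "(p x, p y) \<in> (T - {(a, b), (b, a)})\<^sup>*" if "(x, y) \<in> R\<^sup>*" for x y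
        using that by induction (auto intro: rtrancl_trans step)
      then have "(a, b) \<in> (T - {(a, b), (b, a)})\<^sup>*"
        using path[folded R_def] C(2) b by (metis p_def)
      moreover have "all_bridges T" using root(3)[OF C(1)] by (simp add: T_def tree_iff)
      moreover have "(a, b) \<in> T" using 1 C(2) b by (simp add: T_def)
      ultimately show False by (meson all_bridgesD)
    next
      case 2
      then obtain C where C: "C \<in> graph_components V E" "b \<in> C" using comp E(1) by blast
      have b: "b = root C" using root(2)[OF C] 2(2) by simp
      have "y \<in> - C" if "x \<in> - C" "(x, y) \<in> R" for x y
        using that closed[OF C(1), of x y] root(2)[OF C(1), of y] 2 b sub[OF C(1)] z
        by (auto simp: R_def add_apex_def)
      then have "b \<in> - C"
        using closed_set_rtrancl[of "- C" R a b] path[folded R_def] 2(1) sub[OF C(1)] z by blast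
      then show False using C by simp
    next
      case 3
      then obtain C where C: "C \<in> graph_components V E" "a \<in> C" using comp E(1) by blast
      have a: "a = root C" using root(2)[OF C] 3(2) by simp
      have "y \<in> C" if "x \<in> C" "(x, y) \<in> R" for x y
        using that closed[OF C(1), of x y] root(2)[OF C(1), of x] 3 a sub[OF C(1)] z
        by (auto simp: R_def add_apex_def)
      then have "b \<in> C"
        using closed_set_rtrancl[of C R a b] path[folded R_def] C(2) by blast
      then show False using 3(1) sub[OF C(1)] z by auto
    qed
  qed
  then show ?thesis using lg irr conn by (auto simp: tree_iff)
qed

text \<open>
  A component of the remaining graph contains a neighbour of the apex since the tree is connected. It
  contains only one, since a second neighbour would give a detour around the edge to the first.
\<close>
lemma assembled_del_apex:
  assumes t: "tree (insert z V) T" and z: "z \<notin> V"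
  shows "rooted.assembled V (del_apex z T)"
proof -
  let ?E = "del_apex z T"
  have T: "T \<subseteq> insert z V \<times> insert z V" "sym T" "irrefl T" "finite V" "all_bridges T"
    "\<And>u v. u \<in> insert z V \<Longrightarrow> v \<in> insert z V \<Longrightarrow> (u, v) \<in> T\<^sup>*"
    using t by (auto simp: tree_iff loop_graph_def)
  have E: "?E \<subseteq> V \<times> V" using del_apex_edges[OF T(1,3)] .
  have V: "loop_graph V ?E" using E T(2,4) by (auto simp: loop_graph_def del_apex_def sym_def)
  have "looped_tree C (?E \<inter> C \<times> C)" if C: "C \<in> graph_components V ?E" for C
  proof -
    have sub: "C \<subseteq> V" "z \<notin> C" using component_subset[OF E C] z by auto
    have diff: "?E \<inter> C \<times> C - Id = T \<inter> C \<times> C"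
      using sub(2) T(3) by (auto simp: del_apex_def irrefl_def)
    have conn: "(u, v) \<in> (T \<inter> C \<times> C)\<^sup>*" if "u \<in> C" "v \<in> C" for u v
      using component_connected[OF V C that] rtrancl_r_diff_Id[of "?E \<inter> C \<times> C"] unfolding diff by simp
    obtain v where v: "v \<in> C" using component_nonempty[OF C] by auto
    have "\<exists>x\<in>C. (z, x) \<in> T"
    proof (rule ccontr)
      assume no: "\<not> (\<exists>x\<in>C. (z, x) \<in> T)"
      have "y \<in> C" if "x \<in> C" "(x, y) \<in> T" for x y
      proof -
        have "y \<noteq> z" using no that symD[OF T(2) that(2)] by auto
        moreover have "x \<noteq> z" using that sub by auto
        ultimately have "(x, y) \<in> ?E" using that by (auto simp: del_apex_def)
        then show ?thesis using component_closed[OF V C that(1)] by blast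
      qed
      moreover have "(v, z) \<in> T\<^sup>*" using T(6)[of v z] v sub by auto
      ultimately have "z \<in> C" using closed_set_rtrancl[of C T v z] v by blast
      then show False using sub by simp
    qed
    then obtain x where x: "x \<in> C" "(z, x) \<in> T" by blast
    have unique: "y = x" if "y \<in> C" "(z, y) \<in> T" for y
    proof (rule ccontr)
      assume "y \<noteq> x"
      let ?R = "T - {(z, x), (x, z)}"
      have "(z, y) \<in> ?R" using that \<open>y \<noteq> x\<close> sub(2) by auto
      moreover have "T \<inter> C \<times> C \<subseteq> ?R" using sub(2) by auto
      then have "(y, x) \<in> ?R\<^sup>*" using conn[OF that(1) x(1)] by (meson rtrancl_mono subsetD)
      ultimately have "(z, x) \<in> ?R\<^sup>*" by (rule converse_rtrancl_into_rtrancl)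
      then show False using all_bridgesD[OF T(5) x(2)] by simp
    qed
    have eq: "?E \<inter> C \<times> C = insert (x, x) (T \<inter> C \<times> C)"
    proof (intro equalityI subrelI)
      fix u v assume "(u, v) \<in> ?E \<inter> C \<times> C"
      then show "(u, v) \<in> insert (x, x) (T \<inter> C \<times> C)" using unique[of u] by (auto simp: del_apex_def)
    next
      fix u v assume "(u, v) \<in> insert (x, x) (T \<inter> C \<times> C)"
      then show "(u, v) \<in> ?E \<inter> C \<times> C" using x sub(2) by (auto simp: del_apex_def)
    qed
    have "tree C (T \<inter> C \<times> C)"
      unfolding tree_iff
    proof (intro conjI ballI)
      show "loop_graph C (T \<inter> C \<times> C)"
        using sub(1) T(2,4) by (auto simp: loop_graph_def sym_def intro: finite_subset)
      show "irrefl (T \<inter> C \<times> C)" using T(3) by (auto simp: irrefl_def)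
      show "all_bridges (T \<inter> C \<times> C)" using T(5) by (rule all_bridges_mono) simp
    qed (use conn v in auto)
    then show ?thesis using x(1) eq by (auto simp: looped_tree_def)
  qed
  then show ?thesis using V by (simp add: rooted.assembled_def)
qed

text \<open>
  Deleting the root is, up to isomorphism, a bijection onto the graphs assembled from
  rooted trees with one vertex less. As the root may be moved by an isomorphism, it can be taken to be the vertex \<open>n\<close>.
\<close>
lemma num_rooted_trees_Suc: "num_rooted_trees (Suc n) = rooted.num_msets n"
proof -
  let ?A = "{E. rooted.assembled {..<n} E}" and ?R = "{(T, x). tree {..<Suc n} T \<and> x < Suc n}"
  let ?f = "\<lambda>E. rooted_iso_rel (Suc n) `` {(add_apex n E, n)}"
  have A: "E \<subseteq> {..<n} \<times> {..<n}" if "E \<in> ?A" for E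
    using that by (auto simp: rooted.assembled_def loop_graph_def)
  have ins: "insert n {..<n} = {..<Suc n}" by auto
  have cone: "tree {..<Suc n} (add_apex n E)" if "E \<in> ?A" for E
    using tree_add_apex[of "{..<n}" E n] that by (simp add: ins)
  have "finite ?A"
    using A by (intro finite_subset[of ?A "Pow ({..<n} \<times> {..<n})"]) auto
  moreover have "?f E = ?f F \<longleftrightarrow> iso_rel n `` {E} = iso_rel n `` {F}" if "E \<in> ?A" "F \<in> ?A" for E F
  proof -
    note e = tree_edges(1)[OF cone[OF that(1)]] tree_edges(1)[OF cone[OF that(2)]]
    have irr: "irrefl (add_apex n E)" "irrefl (add_apex n F)"
      using cone[OF that(1)] cone[OF that(2)] by (auto simp: tree_iff)
    have "(\<exists>\<phi>. graph_iso \<phi> {..<Suc n} (add_apex n E) {..<Suc n} (add_apex n F) \<and> \<phi> n = n) \<longleftrightarrow>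
        (\<exists>\<phi>. graph_iso \<phi> {..<n} E {..<n} F)"
    proof
      assume "\<exists>\<phi>. graph_iso \<phi> {..<Suc n} (add_apex n E) {..<Suc n} (add_apex n F) \<and> \<phi> n = n"
      then obtain \<phi> where \<phi>: "graph_iso \<phi> {..<Suc n} (add_apex n E) {..<Suc n} (add_apex n F)" "\<phi> n = n" by blast
      have "graph_iso \<phi> {..<n} (del_apex n (add_apex n E)) {..<n} (del_apex n (add_apex n F))"
        by (rule graph_iso_del_apex[where T="add_apex n E" and S="add_apex n F"]) (use \<phi> e irr in \<open>simp_all add: ins\<close>)
      then show "\<exists>\<phi>. graph_iso \<phi> {..<n} E {..<n} F"
        using del_add_apex[OF A[OF that(1)]] del_add_apex[OF A[OF that(2)]] by auto
    next
      assume "\<exists>\<phi>. graph_iso \<phi> {..<n} E {..<n} F"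
      then obtain \<phi> where "graph_iso \<phi> {..<n} E {..<n} F" by blast
      then show "\<exists>\<phi>. graph_iso \<phi> {..<Suc n} (add_apex n E) {..<Suc n} (add_apex n F) \<and> \<phi> n = n"
        using graph_iso_add_apex[of \<phi> "{..<n}" E "{..<n}" F n] A[OF that(1)]
        by (intro exI[of _ "\<phi>(n := n)"]) (simp add: ins)
    qed
    then show ?thesis
      using e A that by (simp add: rooted_iso_rel_class_eq_iff iso_rel_class_eq_iff)
  qed
  ultimately have "card (?f ` ?A) = card ((\<lambda>E. iso_rel n `` {E}) ` ?A)"
    by (rule card_image_eq_of_kernel)
  also have "(\<lambda>E. iso_rel n `` {E}) ` ?A = ?A // iso_rel n"
    by (rule quotient_eq_image[symmetric])
  also have "?f ` ?A = ?R // rooted_iso_rel (Suc n)"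
  proof (intro equalityI subsetI)
    fix c assume "c \<in> ?f ` ?A"
    then show "c \<in> ?R // rooted_iso_rel (Suc n)"
      using cone by (auto intro!: quotientI)
  next
    fix c assume "c \<in> ?R // rooted_iso_rel (Suc n)"
    then obtain T x where T: "tree {..<Suc n} T" "x < Suc n" and c: "c = rooted_iso_rel (Suc n) `` {(T, x)}"
      by (auto simp: quotient_def)
    \<comment> \<open>exchange the root and the last vertex\<close>
    define \<tau> where "\<tau> = Transposition.transpose x n"
    define S where "S = map_prod \<tau> \<tau> ` T"
    have "bij_betw \<tau> {..<Suc n} {..<Suc n}"
      unfolding \<tau>_def using T(2) by (intro permutes_imp_bij permutes_swap_id) auto
    then have iso: "graph_iso \<tau> {..<Suc n} T {..<Suc n} S" by (simp add: graph_iso_def S_def)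
    have S: "tree {..<Suc n} S" by (rule tree_iso[OF T(1) iso])
    have "c = rooted_iso_rel (Suc n) `` {(S, n)}"
      unfolding c using iso T S tree_edges(1)
      by (subst rooted_iso_rel_class_eq_iff) (auto simp: \<tau>_def intro!: exI[of _ \<tau>])
    moreover have "add_apex n (del_apex n S) = S"
      using S by (intro add_del_apex) (auto simp: tree_iff loop_graph_def)
    moreover have "del_apex n S \<in> ?A"
      using assembled_del_apex[of n "{..<n}" S] S by (simp add: ins)
    ultimately show "c \<in> ?f ` ?A" by (intro image_eqI[of _ _ "del_apex n S"]) simp_all
  qed
  finally show ?thesis by (simp add: num_rooted_trees_def rooted.card_assembled)
qed

lemma num_trees_le_num_rooted_trees: "num_trees n \<le> num_rooted_trees n"
proof -
  let ?R = "{(E, x). tree {..<n} E \<and> x < n}"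
  have "card ((\<lambda>p. iso_rel n `` {fst p}) ` ?R) \<le> card ((\<lambda>p. rooted_iso_rel n `` {p}) ` ?R)"
  proof (rule card_image_le_of_kernel[OF finite_rooted_trees])
    fix p q assume "p \<in> ?R" "q \<in> ?R" "rooted_iso_rel n `` {p} = rooted_iso_rel n `` {q}"
    then show "iso_rel n `` {fst p} = iso_rel n `` {fst q}"
      using rooted_iso_rel_class_eq_iff[of "fst p" n "fst q" "snd p" "snd q"] iso_rel_class_eq_iff[of "fst p" n "fst q"]
        tree_edges(1)[of "{..<n}" "fst p"] tree_edges(1)[of "{..<n}" "fst q"] by auto
  qed
  moreover have "(\<lambda>p. iso_rel n `` {fst p}) ` ?R = {E. tree {..<n} E} // iso_rel n"
  proof -
    have "{E. tree {..<n} E} = fst ` ?R"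
    proof (intro equalityI subsetI)
      fix E assume "E \<in> {E. tree {..<n} E}"
      then have "tree {..<n} E" "0 < n" by (auto simp: tree_iff)
      then show "E \<in> fst ` ?R" by (intro image_eqI[of _ _ "(E, 0)"]) auto
    next
      fix E assume "E \<in> fst ` ?R"
      then obtain p where "p \<in> ?R" "E = fst p" by blast
      then show "E \<in> {E. tree {..<n} E}" by auto
    qed
    then show ?thesis by (simp only: quotient_eq_image image_image)
  qed
  moreover have "(\<lambda>p. rooted_iso_rel n `` {p}) ` ?R = ?R // rooted_iso_rel n"
    by (rule quotient_eq_image[symmetric])
  ultimately show ?thesis by (simp add: num_trees_def num_rooted_trees_def)
qed

text \<open>
  Each tree is identified with a fixed representative of its class by a chosen isomorphism. A rooted
  tree is then determined up to isomorphism by this class and by the image of its root.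
\<close>
lemma num_rooted_trees_le: "num_rooted_trees n \<le> n * num_trees n"
proof -
  let ?R = "{(E, x). tree {..<n} E \<and> x < n}" and ?Q = "{E. tree {..<n} E} // iso_rel n"
  \<comment> \<open>a representative of each class; every tree of the class is isomorphic to it\<close>
  define rep where "rep c = (SOME F. F \<in> c)" for c :: "(nat \<times> nat) set set"
  have "\<exists>\<phi>. graph_iso \<phi> {..<n} E {..<n} (rep (iso_rel n `` {E}))" for E
  proof -
    have "E \<in> iso_rel n `` {E}" using graph_iso_refl[of "{..<n}" E] by (auto simp: iso_rel_def)
    then have "rep (iso_rel n `` {E}) \<in> iso_rel n `` {E}" unfolding rep_def by (rule someI)
    then show ?thesis by (auto simp: iso_rel_def)
  qed
  then obtain \<phi> where \<phi>: "\<And>E. graph_iso (\<phi> E) {..<n} E {..<n} (rep (iso_rel n `` {E}))" by metis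
  let ?g = "\<lambda>(E, x). (iso_rel n `` {E}, \<phi> E x)"
  have "card ((\<lambda>p. rooted_iso_rel n `` {p}) ` ?R) \<le> card (?g ` ?R)"
  proof (rule card_image_le_of_kernel[OF finite_rooted_trees])
    fix p q assume "p \<in> ?R" "q \<in> ?R" and eq: "?g p = ?g q"
    then obtain E x F y where p: "p = (E, x)" "tree {..<n} E" "x < n" and q: "q = (F, y)" "tree {..<n} F" "y < n"
      by auto
    note e = tree_edges(1)[OF p(2)] tree_edges(1)[OF q(2)]
    have c: "iso_rel n `` {E} = iso_rel n `` {F}" "\<phi> E x = \<phi> F y" using eq p q by auto
    have "graph_iso (inv_into {..<n} (\<phi> F)) {..<n} (rep (iso_rel n `` {F})) {..<n} F"
      by (rule graph_iso_inv[OF \<phi> e(2)])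
    then have "graph_iso (inv_into {..<n} (\<phi> F) \<circ> \<phi> E) {..<n} E {..<n} F"
      using graph_iso_trans[OF \<phi>[of E]] c(1) by simp
    moreover have "inj_on (\<phi> F) {..<n}" using \<phi>[of F] by (simp add: graph_iso_def bij_betw_def)
    then have "(inv_into {..<n} (\<phi> F) \<circ> \<phi> E) x = y" using c(2) q(3) by simp
    ultimately show "rooted_iso_rel n `` {p} = rooted_iso_rel n `` {q}"
      using rooted_iso_rel_class_eq_iff[OF e p(3) q(3)] p(1) q(1) by blast
  qed
  also have "\<dots> \<le> card (?Q \<times> {..<n})"
  proof (rule card_mono)
    have "?Q = (\<lambda>E. iso_rel n `` {E}) ` {E. tree {..<n} E}" by (rule quotient_eq_image)
    then show "finite (?Q \<times> {..<n})" using finite_trees by simp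
    have "\<phi> E x < n" if "x < n" for E x
      using \<phi>[of E] that by (auto simp: graph_iso_def bij_betw_def)
    then show "?g ` ?R \<subseteq> ?Q \<times> {..<n}" by (auto intro: quotientI)
  qed
  also have "(\<lambda>p. rooted_iso_rel n `` {p}) ` ?R = ?R // rooted_iso_rel n"
    by (rule quotient_eq_image[symmetric])
  finally show ?thesis by (simp add: num_trees_def num_rooted_trees_def card_cartesian_product mult.commute)
qed

section \<open>The generating function of rooted trees at its radius of convergence\<close>

text \<open>
  The part of \<open>- log (1 - u) = u + u\<^sup>2/2 + \<dots>\<close> beyond the linear term. It is of order \<open>u\<^sup>2\<close>, so a series
  with these terms at \<open>u = x\<^sup>k\<close> converges for larger \<open>x\<close> than the series of the linear terms.
\<close>
definition log_geom_tail :: "real \<Rightarrow> real" where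
  "log_geom_tail u = log_geom u - u"

lemma log_geom_bounds:
  assumes "0 \<le> u" "u < 1" shows "u \<le> log_geom u" "log_geom u \<le> u / (1 - u)"
proof -
  show "u \<le> log_geom u" using ln_le_minus_one[of "1 - u"] assms by simp
  have "log_geom u = ln (1 / (1 - u))" using assms by (simp add: ln_div)
  also have "\<dots> \<le> 1 / (1 - u) - 1" using assms by (intro ln_le_minus_one) simp
  also have "\<dots> = u / (1 - u)" using assms by (simp add: field_simps)
  finally show "log_geom u \<le> u / (1 - u)" .
qed

lemma log_geom_tail_bounds:
  assumes "0 \<le> u" "u < 1" shows "0 \<le> log_geom_tail u" "log_geom_tail u \<le> u\<^sup>2 / (1 - u)"
proof -
  have "u / (1 - u) - u = u\<^sup>2 / (1 - u)" using assms by (simp add: field_simps power2_eq_square)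
  then show "0 \<le> log_geom_tail u" "log_geom_tail u \<le> u\<^sup>2 / (1 - u)"
    using log_geom_bounds[OF assms] by (auto simp: log_geom_tail_def)
qed

lemma log_geom_tail_mono:
  assumes "0 \<le> u" "u \<le> v" "v < 1" shows "log_geom_tail u \<le> log_geom_tail v"
proof -
  have "ln ((1 - v) / (1 - u)) \<le> (1 - v) / (1 - u) - 1"
    using assms by (intro ln_le_minus_one) simp
  also have "\<dots> = - ((v - u) / (1 - u))" using assms by (simp add: field_simps)
  also have "\<dots> \<le> - (v - u)"
  proof -
    have "(v - u) * (1 - u) \<le> v - u" using assms by (intro mult_left_le) auto
    then show ?thesis using assms by (simp add: field_simps)
  qed
  finally show ?thesis using assms by (simp add: log_geom_tail_def ln_div)
qed

lemma continuous_on_log_geom_tail: "continuous_on {..<1} log_geom_tail"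
  unfolding log_geom_tail_def by (intro continuous_intros) auto

lemma summable_log_geom:
  fixes a :: "nat \<Rightarrow> nat"
  assumes "a 0 = 0" "0 \<le> x" "x < 1" "summable (\<lambda>k. real (a k) * x ^ k)"
  shows "summable (\<lambda>k. real (a k) * log_geom (x ^ k))"
proof (rule summable_comparison_test')
  show "summable (\<lambda>k. real (a k) * x ^ k * (1 / (1 - x)))" using assms(4) by (rule summable_mult2)
  fix k
  show "norm (real (a k) * log_geom (x ^ k)) \<le> real (a k) * x ^ k * (1 / (1 - x))"
  proof (cases "k = 0")
    case False
    have xk: "0 \<le> x ^ k" "x ^ k \<le> x" using assms(2,3) False
      by (auto intro: power_le_one_iff[THEN iffD2] simp: power_decreasing[of 1 k x, simplified])
    have "log_geom (x ^ k) \<le> x ^ k / (1 - x ^ k)" using xk assms(3) by (intro log_geom_bounds) auto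
    also have "\<dots> \<le> x ^ k / (1 - x)" using xk assms(3) by (intro divide_left_mono) auto
    finally have "real (a k) * log_geom (x ^ k) \<le> real (a k) * (x ^ k / (1 - x))" by (intro mult_left_mono) auto
    moreover have "0 \<le> log_geom (x ^ k)" using log_geom_bounds(1)[of "x ^ k"] xk assms(3) by linarith
    ultimately show ?thesis by (simp add: abs_mult)
  qed (simp add: assms(1))
qed

lemma euler_product:
  fixes a :: "nat \<Rightarrow> nat"
  assumes "a 0 = 0" "0 \<le> x" "x < 1" "summable (\<lambda>k. real (a k) * log_geom (x ^ k))"
  shows "(\<lambda>k. (1 - x ^ Suc k) ^ a (Suc k)) has_prod exp (- (\<Sum>k. real (a k) * log_geom (x ^ k)))"
proof -
  let ?f = "\<lambda>k. real (a k) * log_geom (x ^ k)"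
  have "(\<lambda>k. ?f (Suc k)) sums (suminf ?f - ?f 0)"
    using assms(4) sums_Suc_iff[of ?f] by (simp add: summable_sums)
  then have "(\<lambda>k. - ?f (Suc k)) sums (- suminf ?f)"
    using assms(1) sums_minus by fastforce
  then have "(\<lambda>k. exp (- ?f (Suc k))) has_prod exp (- suminf ?f)"
    unfolding has_prod_def by (intro disjI1 sums_imp_has_prod_exp)
  moreover have "exp (- ?f (Suc k)) = (1 - x ^ Suc k) ^ a (Suc k)" for k
  proof -
    have "x ^ Suc k < 1" using assms(2,3) by (subst power_less_one_iff) auto
    then show ?thesis by (simp add: exp_of_nat_mult)
  qed
  ultimately show ?thesis by simp
qed

text \<open>
  The colours correspond to the multisets of colours of total weight one less, as rooted
  trees do. With \<open>T(x) = \<Sum>k. a\<^sub>k x\<^sup>k\<close> for the numbers \<open>a\<^sub>k\<close> of colours, this reads \<open>T(x) = c(x) exp (T(x))\<close> with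
  \<open>c(x) = x * exp (tail_sum x)\<close>.
\<close>
locale self_similar_colours = weighted_colours +
  assumes num_colours_Suc: "num_colours (Suc n) = num_msets n"
begin

lemma tail_term_bound:
  assumes "0 \<le> x" "x \<le> y" "y < 1"
  shows "norm (real (num_colours k) * log_geom_tail (x ^ k)) \<le> real (num_colours k) * (y\<^sup>2) ^ k * (1 / (1 - y))"
proof (cases "k = 0")
  case False
  have xk: "0 \<le> x ^ k" "x ^ k \<le> y ^ k" using assms by (auto intro: power_mono)
  have yk: "y ^ k \<le> y" using assms False power_decreasing[of 1 k y] by simp
  have u: "0 \<le> x ^ k" "x ^ k < 1" using xk yk assms by auto
  have "log_geom_tail (x ^ k) \<le> (x ^ k)\<^sup>2 / (1 - x ^ k)" by (rule log_geom_tail_bounds[OF u])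
  also have "\<dots> \<le> (y ^ k)\<^sup>2 / (1 - y)" using xk yk assms by (intro frac_le power_mono) auto
  also have "(y ^ k)\<^sup>2 = (y\<^sup>2) ^ k" by (simp add: power_mult[symmetric] mult.commute)
  finally have "real (num_colours k) * log_geom_tail (x ^ k) \<le> real (num_colours k) * ((y\<^sup>2) ^ k / (1 - y))"
    by (intro mult_left_mono) auto
  then show ?thesis using log_geom_tail_bounds[OF u] by (simp add: abs_mult)
qed (simp add: num_colours_0)

definition tail_sum :: "real \<Rightarrow> real" where
  "tail_sum x = (\<Sum>k. real (num_colours k) * log_geom_tail (x ^ k))"

lemma summable_tail:
  assumes "0 \<le> x" "x < 1" "summable (\<lambda>k. real (num_colours k) * (x\<^sup>2) ^ k)"
  shows "summable (\<lambda>k. real (num_colours k) * log_geom_tail (x ^ k))"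
  using tail_term_bound[OF assms(1) order_refl assms(2)]
  by (intro summable_comparison_test'[OF summable_mult2[OF assms(3)]])

lemma tail_term_nonneg: "0 \<le> x \<Longrightarrow> x < 1 \<Longrightarrow> 0 \<le> real (num_colours k) * log_geom_tail (x ^ k)"
  using log_geom_tail_bounds(1)[of "x ^ k"]
  by (cases "k = 0") (auto simp: num_colours_0 power_less_one_iff)

lemma continuous_on_tail_sum:
  assumes "0 \<le> y" "y < 1" "summable (\<lambda>k. real (num_colours k) * (y\<^sup>2) ^ k)"
  shows "continuous_on {0..y} tail_sum"
proof -
  have "uniform_limit {0..y} (\<lambda>n x. \<Sum>k<n. real (num_colours k) * log_geom_tail (x ^ k))
      (\<lambda>x. \<Sum>k. real (num_colours k) * log_geom_tail (x ^ k)) sequentially"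
    by (rule Weierstrass_m_test[OF tail_term_bound[OF _ _ assms(2)] summable_mult2[OF assms(3)]]) auto
  moreover have "continuous_on {0..y} (\<lambda>x. real (num_colours k) * log_geom_tail (x ^ k))" for k
  proof (cases "k = 0")
    case False
    then show ?thesis using assms(1,2)
      by (intro continuous_intros continuous_on_compose2[OF continuous_on_log_geom_tail])
        (auto simp: power_less_one_iff)
  qed (simp add: num_colours_0)
  then have "continuous_on {0..y} (\<lambda>x. \<Sum>k<n. real (num_colours k) * log_geom_tail (x ^ k))" for n
    by (intro continuous_on_sum)
  ultimately show ?thesis unfolding tail_sum_def
    by (intro uniform_limit_theorem[where F = sequentially]) auto
qed

text \<open>
  The functional equation as an inequality for partial sums, by which convergence of the series is
  proved beyond the points where it is already known.
\<close>
lemma partial_sum_le: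
  assumes x: "0 \<le> x" "x < 1" and summ: "summable (\<lambda>k. real (num_colours k) * (x\<^sup>2) ^ k)"
  shows "(\<Sum>k\<le>Suc N. real (num_colours k) * x ^ k) \<le>
    x * exp (tail_sum x) * exp (\<Sum>k\<le>N. real (num_colours k) * x ^ k)"
proof -
  have "(\<Sum>k\<le>Suc N. real (num_colours k) * x ^ k) = x * (\<Sum>n\<le>N. real (num_msets n) * x ^ n)"
    by (subst sum.atMost_Suc_shift) (simp add: num_colours_0 num_colours_Suc sum_distrib_left mult_ac)
  also have "\<dots> \<le> x * exp (\<Sum>k\<le>N. real (num_colours k) * log_geom (x ^ k))"
    using x by (intro mult_left_mono num_msets_partial_sum_le)
  also have "(\<Sum>k\<le>N. real (num_colours k) * log_geom (x ^ k)) =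
      (\<Sum>k\<le>N. real (num_colours k) * x ^ k) + (\<Sum>k\<le>N. real (num_colours k) * log_geom_tail (x ^ k))"
    unfolding sum.distrib[symmetric] log_geom_tail_def by (intro sum.cong) (simp_all add: algebra_simps)
  also have "x * exp \<dots> \<le> x * exp ((\<Sum>k\<le>N. real (num_colours k) * x ^ k) + tail_sum x)"
    unfolding tail_sum_def using x tail_term_nonneg[OF x] summable_tail[OF x summ]
    by (intro mult_left_mono) (auto intro!: sum_le_suminf)
  also have "\<dots> = x * exp (tail_sum x) * exp (\<Sum>k\<le>N. real (num_colours k) * x ^ k)"
    by (simp add: exp_add)
  finally show ?thesis .
qed

lemma functional_equation:
  assumes x: "0 \<le> x" "x < 1" and summ: "summable (\<lambda>k. real (num_colours k) * x ^ k)"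
  shows "(\<Sum>k. real (num_colours k) * x ^ k) = x * exp (\<Sum>k. real (num_colours k) * log_geom (x ^ k))"
proof -
  have "(\<lambda>n. x * (real (num_msets n) * x ^ n)) sums (x * exp (\<Sum>k. real (num_colours k) * log_geom (x ^ k)))"
    using x num_colours_0 summ by (intro sums_mult num_msets_sums summable_log_geom)
  then have "(\<lambda>n. real (num_colours (Suc n)) * x ^ Suc n) sums (x * exp (\<Sum>k. real (num_colours k) * log_geom (x ^ k)))"
    by (simp add: num_colours_Suc mult_ac)
  then have "(\<lambda>n. real (num_colours n) * x ^ n) sums (x * exp (\<Sum>k. real (num_colours k) * log_geom (x ^ k)) + real (num_colours 0) * x ^ 0)"
    by (subst (asm) sums_Suc_iff) (simp add: num_colours_0)
  then show ?thesis by (simp add: sums_iff num_colours_0)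
qed

lemma functional_equation_tail:
  assumes x: "0 \<le> x" "x < 1" and summ: "summable (\<lambda>k. real (num_colours k) * x ^ k)"
    "summable (\<lambda>k. real (num_colours k) * (x\<^sup>2) ^ k)"
  shows "(\<Sum>k. real (num_colours k) * x ^ k) = x * exp (tail_sum x) * exp (\<Sum>k. real (num_colours k) * x ^ k)"
proof -
  have "(\<Sum>k. real (num_colours k) * log_geom (x ^ k)) =
      (\<Sum>k. real (num_colours k) * x ^ k + real (num_colours k) * log_geom_tail (x ^ k))"
    by (simp add: log_geom_tail_def algebra_simps)
  also have "\<dots> = (\<Sum>k. real (num_colours k) * x ^ k) + tail_sum x"
    unfolding tail_sum_def by (rule suminf_add[symmetric, OF summ(1) summable_tail[OF x summ(2)]])
  finally have "exp (\<Sum>k. real (num_colours k) * log_geom (x ^ k)) =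
      exp (tail_sum x) * exp (\<Sum>k. real (num_colours k) * x ^ k)"
    by (simp only: exp_add mult.commute)
  then show ?thesis using functional_equation[OF x summ(1)] by (simp only: mult.assoc)
qed

text \<open>
  One is a fixed bound under the iteration \<open>y \<mapsto> c(x) exp y\<close> that controls the partial sums.
\<close>
lemma summable_of_critical_bound:
  assumes x: "0 \<le> x" "x < 1" and summ: "summable (\<lambda>k. real (num_colours k) * (x\<^sup>2) ^ k)"
    and crit: "x * exp (tail_sum x) * exp 1 \<le> 1"
  shows "summable (\<lambda>k. real (num_colours k) * x ^ k)"
proof -
  have le1: "(\<Sum>k\<le>N. real (num_colours k) * x ^ k) \<le> 1" for N
  proof (induction N)
    case (Suc N)
    have "(\<Sum>k\<le>Suc N. real (num_colours k) * x ^ k) \<le>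
        x * exp (tail_sum x) * exp (\<Sum>k\<le>N. real (num_colours k) * x ^ k)"
      by (rule partial_sum_le[OF x summ])
    also have "\<dots> \<le> x * exp (tail_sum x) * exp 1"
      using Suc x by (intro mult_left_mono) auto
    finally show ?case using crit by linarith
  qed (simp add: num_colours_0)
  have "(\<Sum>k<N. real (num_colours k) * x ^ k) \<le> 1" for N
  proof -
    have "(\<Sum>k<N. real (num_colours k) * x ^ k) \<le> (\<Sum>k\<le>N. real (num_colours k) * x ^ k)"
      using x by (intro sum_mono2) auto
    then show ?thesis using le1[of N] by linarith
  qed
  then show ?thesis using x by (intro summableI_nonneg_bounded) auto
qed

text \<open>
  The function \<open>y exp (- y)\<close> attains its maximum \<open>exp (- 1)\<close> only at \<open>y = 1\<close>, and \<open>T(x) exp (- T(x)) = c(x)\<close> with \<open>c\<close> strictly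
  increasing. A value above one would force \<open>c\<close> to decrease; a value below one would leave room for the
  series to converge beyond \<open>a\<close>.
\<close>
theorem sum_at_radius_eq_1:
  assumes a: "0 < a" "a < 1" and summ: "summable (\<lambda>k. real (num_colours k) * a ^ k)"
    and radius: "\<And>x. a < x \<Longrightarrow> \<not> summable (\<lambda>k. real (num_colours k) * x ^ k)"
  shows "(\<Sum>k. real (num_colours k) * a ^ k) = 1"
proof -
  define T where "T x = (\<Sum>k. real (num_colours k) * x ^ k)" for x :: real
  have mono: "summable (\<lambda>k. real (num_colours k) * x ^ k)" if "0 \<le> x" "x \<le> a" for x
    using that by (intro summable_comparison_test'[OF summ]) (auto intro: mult_left_mono power_mono)
  have sq: "x\<^sup>2 \<le> a" if "0 \<le> x" "x \<le> a" for x
    using that a by (metis less_imp_le mult_left_le order_trans power2_eq_square)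
  have eq: "T x = x * exp (tail_sum x) * exp (T x)" if "0 \<le> x" "x \<le> a" for x
    unfolding T_def using that a sq[OF that] by (intro functional_equation_tail mono) auto
  have pos: "0 < T x" if "0 < x" "x \<le> a" for x
    using that by (subst eq) auto
  have le: "T a \<le> 1"
  proof (rule ccontr)
    assume "\<not> T a \<le> 1"
    then have "\<forall>\<^sub>F N in sequentially. 1 < (\<Sum>k<N. real (num_colours k) * a ^ k)"
      unfolding T_def using order_tendstoD(1)[OF summable_LIMSEQ[OF summ]] by simp
    then obtain N where N: "1 < (\<Sum>k<N. real (num_colours k) * a ^ k)"
      by (auto simp: eventually_sequentially)
    have "((\<lambda>x. \<Sum>k<N. real (num_colours k) * x ^ k) \<longlongrightarrow> (\<Sum>k<N. real (num_colours k) * a ^ k)) (at_left a)"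
      by (intro tendsto_intros)
    then have "\<forall>\<^sub>F x in at_left a. 1 < (\<Sum>k<N. real (num_colours k) * x ^ k)"
      using N by (rule order_tendstoD(1))
    moreover have "\<forall>\<^sub>F x in at_left a. 0 < x \<and> x < a"
      using a by (auto simp: eventually_at_left[of 0] intro: exI[of _ 0])
    ultimately have "\<forall>\<^sub>F x in at_left a. 1 < (\<Sum>k<N. real (num_colours k) * x ^ k) \<and> 0 < x \<and> x < a"
      by eventually_elim auto
    then obtain x where x: "1 < (\<Sum>k<N. real (num_colours k) * x ^ k)" "0 < x" "x < a"
      using eventually_happens'[OF trivial_limit_at_left_real] by blast
    have "1 < T x"
      using x unfolding T_def by (intro less_le_trans[OF x(1)] sum_le_suminf mono) auto
    have Tle: "T x \<le> T a"
      unfolding T_def using x summ by (intro suminf_le mono mult_left_mono power_mono) auto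
    have S: "tail_sum x \<le> tail_sum a"
      unfolding tail_sum_def
    proof (intro suminf_le summable_tail mono)
      fix k
      show "real (num_colours k) * log_geom_tail (x ^ k) \<le> real (num_colours k) * log_geom_tail (a ^ k)"
        using x a by (cases "k = 0")
          (auto simp: num_colours_0 power_less_one_iff intro!: mult_left_mono log_geom_tail_mono power_mono)
    qed (use x a sq in auto)
    have log_eq: "ln (T y) - T y = ln y + tail_sum y" if "0 < y" "y \<le> a" for y
    proof -
      have "ln (T y) = ln (y * exp (tail_sum y) * exp (T y))" using eq[of y] that by simp
      also have "\<dots> = ln y + tail_sum y + T y" using that by (simp add: ln_mult)
      finally show ?thesis by simp
    qed
    have "ln (T a) - ln (T x) = ln (T a / T x)" using pos[of x] pos[of a] x a by (simp add: ln_div)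
    also have "\<dots> \<le> T a / T x - 1" using pos[of x] pos[of a] x a by (intro ln_le_minus_one) auto
    also have "\<dots> = (T a - T x) / T x" using \<open>1 < T x\<close> by (simp add: field_simps)
    also have "\<dots> \<le> (T a - T x) / 1" using \<open>1 < T x\<close> Tle by (intro divide_left_mono) auto
    finally have "ln (T a) - T a \<le> ln (T x) - T x" by simp
    moreover have "ln x + tail_sum x < ln a + tail_sum a" using S x a by (simp add: add_less_le_mono)
    ultimately show False using log_eq[of x] log_eq[of a] x a by simp
  qed
  have "\<not> T a < 1"
  proof
    assume less: "T a < 1"
    define c where "c x = x * exp (tail_sum x)" for x
    \<comment> \<open>the function c is continuous up to this point, which lies beyond a\<close>
    define y where "y = sqrt a"
    have y: "a < y" "y < 1" "y\<^sup>2 = a" "0 < y"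
      using a by (auto simp: y_def real_less_rsqrt power2_eq_square)
    have "T a = c a * exp (T a)" using eq[of a] a by (simp add: c_def)
    then have c: "c a = T a * exp (- T a)" by (simp add: exp_minus field_simps)
    have "ln (T a) < T a - 1"
      using ln_le_minus_one[OF pos[of a]] ln_eq_minus_one[OF pos[of a]] a less by fastforce
    then have "T a < exp (T a - 1)" using pos[of a] a by (metis exp_ln exp_less_mono order_refl)
    then have "c a * exp 1 < 1" unfolding c by (simp add: exp_diff exp_minus field_simps)
    moreover have "continuous_on {0..y} (\<lambda>x. c x * exp 1)"
      unfolding c_def using y summ by (intro continuous_intros continuous_on_tail_sum) auto
    then have "continuous_on {a..y} (\<lambda>x. c x * exp 1)"
      by (rule continuous_on_subset) (use a in auto)
    then have "((\<lambda>x. c x * exp 1) \<longlongrightarrow> c a * exp 1) (at_right a)"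
      using y(1) by (auto simp: continuous_on_def at_within_Icc_at_right[OF y(1), symmetric])
    ultimately have "\<forall>\<^sub>F x in at_right a. c x * exp 1 < 1"
      using order_tendstoD(2) by blast
    moreover have "\<forall>\<^sub>F x in at_right a. a < x \<and> x < y"
      using y by (auto simp: eventually_at_right[of a y] intro: exI[of _ y])
    ultimately have "\<forall>\<^sub>F x in at_right a. c x * exp 1 < 1 \<and> a < x \<and> x < y"
      by eventually_elim auto
    then obtain x where x: "c x * exp 1 < 1" "a < x" "x < y"
      using eventually_happens'[OF trivial_limit_at_right_real] by blast
    have "x\<^sup>2 \<le> a" using x a y(3) power_mono[of x y 2] by simp
    then have "summable (\<lambda>k. real (num_colours k) * (x\<^sup>2) ^ k)" by (intro mono) auto
    from summable_of_critical_bound[OF _ _ this] have "summable (\<lambda>k. real (num_colours k) * x ^ k)"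
      using x a y by (simp add: c_def)
    then show False using radius[OF x(2)] by blast
  qed
  with le show ?thesis unfolding T_def by simp
qed

end

interpretation rooted_trees: self_similar_colours rooted.classes fst
  by unfold_locales (simp add: num_rooted_trees_Suc[symmetric] num_rooted_trees_eq)

section \<open>Infinitely divisible distributions on the natural numbers\<close>

lemma fps_nth_power_nonneg:
  fixes B :: "real fps" assumes "\<And>n. 0 \<le> B $ n" shows "0 \<le> (B ^ i) $ n"
  by (induction i arbitrary: n) (auto simp: fps_mult_nth assms intro!: sum_nonneg)

lemma fps_exp_compose_nonneg:
  fixes B :: "real fps" assumes "\<And>n. 0 \<le> B $ n" "0 \<le> s" shows "0 \<le> (fps_exp s oo B) $ n"
  using assms by (auto simp: fps_compose_nth fps_nth_power_nonneg intro!: sum_nonneg)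

lemma fps_exp_compose_mono:
  fixes B :: "real fps" assumes "\<And>n. 0 \<le> B $ n" "0 \<le> s" "s \<le> t"
  shows "(fps_exp s oo B) $ n \<le> (fps_exp t oo B) $ n"
  using assms by (auto simp: fps_compose_nth fps_nth_power_nonneg intro!: sum_mono mult_right_mono divide_right_mono power_mono)

text \<open>
  The coefficient form of \<open>x H' = s (x B') H\<close> for \<open>H = exp (s B)\<close>, where \<open>x B'\<close> has the coefficients \<open>A\<^sub>k\<close>.
\<close>
lemma fps_exp_compose_recurrence:
  fixes A :: "nat \<Rightarrow> real" and s :: real
  defines "H \<equiv> fps_exp s oo Abs_fps (\<lambda>n. A n / n)"
  assumes "A 0 = 0"
  shows "real n * H $ n = s * (\<Sum>k\<le>n. A k * H $ (n - k))"
proof -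
  let ?B = "Abs_fps (\<lambda>n. A n / n)"
  have B: "fps_X * fps_deriv ?B = Abs_fps A"
    by (rule fps_ext) (auto simp: assms gr0_conv_Suc)
  have "fps_deriv H = fps_const s * H * fps_deriv ?B"
    unfolding H_def by (subst fps_compose_deriv) (auto simp: fps_compose_mult_distrib)
  then have "fps_X * fps_deriv H = fps_const s * (Abs_fps A * H)"
    unfolding B[symmetric] by (simp add: algebra_simps)
  then have "(fps_X * fps_deriv H) $ n = (fps_const s * (Abs_fps A * H)) $ n" by simp
  then show ?thesis
    by (simp add: fps_mult_fps_X_deriv_shift fps_mult_left_const_nth) (simp add: fps_mult_nth atLeast0AtMost)
qed

lemma recurrence_unique:
  fixes A :: "nat \<Rightarrow> real"
  assumes "A 0 = 0" and f: "\<And>n. real n * f n = (\<Sum>k\<le>n. A k * f (n - k))"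
    and g: "\<And>n. real n * g n = (\<Sum>k\<le>n. A k * g (n - k))" and "g 0 = 1"
  shows "f n = f 0 * g n"
proof (induction n rule: less_induct)
  case (less n)
  show ?case
  proof (cases "n = 0")
    case False
    have "real n * f n = (\<Sum>k\<le>n. A k * (f 0 * g (n - k)))"
      unfolding f by (intro sum.cong refl) (metis assms(1) diff_less less less_nat_zero_code mult_zero_left neq0_conv False)
    also have "\<dots> = f 0 * (real n * g n)" unfolding g by (simp add: sum_distrib_left mult_ac)
    finally show ?thesis using False by simp
  qed (simp add: assms)
qed

lemma sums_pmf_nat: "pmf P sums 1" for P :: "nat pmf"
proof -
  have "(\<lambda>n. measure P {n}) sums measure P (\<Union>n. {n})"
    by (rule measure_pmf.finite_measure_UNION) (auto simp: disjoint_family_on_def)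
  then show ?thesis by (simp add: measure_pmf_single)
qed

lemma pmf_nat_of_sums:
  assumes "\<And>n. 0 \<le> f n" "f sums 1"
  shows "\<exists>P :: nat pmf. \<forall>n. pmf P n = f n"
proof -
  have "(\<integral>\<^sup>+ n. ennreal (f n) \<partial>count_space UNIV) = 1"
    using assms by (simp add: nn_integral_count_space_nat suminf_ennreal2 sums_iff)
  then have "pmf (embed_pmf f) n = f n" for n
    using assms by (intro pmf_embed_pmf) auto
  then show ?thesis by blast
qed

lemma pmf_add_eq_fps_mult:
  fixes p q :: "nat pmf"
  shows "pmf (map_pmf (\<lambda>(x, y). x + y) (pair_pmf p q)) n = (Abs_fps (pmf p) * Abs_fps (pmf q)) $ n"
proof -
  have "(\<lambda>(x, y). x + y) -` {n} = (\<lambda>i. (i, n - i)) ` {..n}" by (auto simp: image_iff)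
  then have "pmf (map_pmf (\<lambda>(x, y). x + y) (pair_pmf p q)) n =
      measure (pair_pmf p q) ((\<lambda>i. (i, n - i)) ` {..n})"
    by (simp add: pmf_map)
  also have "\<dots> = (\<Sum>i\<le>n. pmf p i * pmf q (n - i))"
    by (subst measure_measure_pmf_finite) (auto simp: sum.reindex inj_on_def pmf_pair)
  finally show ?thesis by (simp add: fps_mult_nth atLeast0AtMost)
qed

lemma pmf_sum_Pi_pmf:
  fixes q :: "nat pmf"
  assumes "finite I"
  shows "pmf (map_pmf (\<lambda>\<omega>. \<Sum>i\<in>I. \<omega> i) (Pi_pmf I 0 (\<lambda>_. q))) n = (Abs_fps (pmf q) ^ card I) $ n"
  using assms
proof (induction I arbitrary: n rule: finite_induct)
  case empty
  then show ?case by (simp add: pmf_return)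
next
  case (insert i I)
  let ?R = "map_pmf (\<lambda>\<omega>. \<Sum>i\<in>I. \<omega> i) (Pi_pmf I 0 (\<lambda>_. q))"
  have "map_pmf (\<lambda>\<omega>. \<Sum>i\<in>insert i I. \<omega> i) (Pi_pmf (insert i I) 0 (\<lambda>_. q)) =
      map_pmf (\<lambda>(x, y). x + y) (pair_pmf q ?R)"
  proof -
    have *: "(\<Sum>j\<in>I. if j = i then x else f j) = (\<Sum>j\<in>I. f j)" for f :: "_ \<Rightarrow> nat" and x
      using insert by (intro sum.cong) auto
    have "pair_pmf q ?R = map_pmf (\<lambda>(x, f). (x, \<Sum>i\<in>I. f i)) (pair_pmf q (Pi_pmf I 0 (\<lambda>_. q)))"
      using pair_map_pmf2[of q] by (simp add: case_prod_unfold apsnd_def map_prod_def)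
    then show ?thesis
      using insert(1,2)
      by (simp add: Pi_pmf_insert map_pmf_comp case_prod_unfold * cong: sum.cong)
  qed
  moreover have "Abs_fps (pmf ?R) = Abs_fps (pmf q) ^ card I"
    by (rule fps_ext) (use insert in simp)
  ultimately show ?case using insert by (simp add: pmf_add_eq_fps_mult)
qed

text \<open>
  Independent variables with distribution \<open>q\<close> are the coordinates of a product distribution, and the
  generating function of their sum is the \<open>m\<close>-th power of that of \<open>q\<close>.
\<close>
lemma infinitely_divisible_pmfI:
  fixes P :: "nat pmf"
  assumes "\<And>m. 1 \<le> m \<Longrightarrow> \<exists>q :: nat pmf. \<forall>n. pmf P n = (Abs_fps (pmf q) ^ m) $ n"
  shows "infinitely_divisible (distr (measure_pmf P) borel real)"
  unfolding infinitely_divisible_def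
proof (intro conjI allI impI)
  show "prob_space (distr (measure_pmf P) borel real)"
    by (rule measure_pmf.prob_space_distr) simp
  show "sets (distr (measure_pmf P) borel real) = sets borel" by simp
  fix m :: nat assume "1 \<le> m"
  from assms[OF this] obtain q where q: "\<And>n. pmf P n = (Abs_fps (pmf q) ^ m) $ n" by blast
  let ?Pi = "Pi_pmf {1..m} 0 (\<lambda>_. map_pmf real q)"
  let ?X = "\<lambda>i (\<omega> :: nat \<Rightarrow> real). \<omega> i"
  have "prob_space.indep_vars ?Pi (\<lambda>_. count_space UNIV) ?X {1..m}"
    by (rule indep_vars_Pi_pmf) simp
  then have indep: "prob_space.indep_vars ?Pi (\<lambda>_. borel) ?X {1..m}"
    using prob_space.indep_vars_compose2[OF measure_pmf.prob_space_axioms, of ?Pi "\<lambda>_. count_space UNIV" ?X "{1..m}" "\<lambda>_ x. x" "\<lambda>_. borel"]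
    by simp
  have X: "distr ?Pi borel (?X i) = distr (map_pmf real q) borel (\<lambda>x. x)" if "i \<in> {1..m}" for i
  proof -
    have "map_pmf (\<lambda>f. f i) ?Pi = map_pmf real q" using that by (simp add: Pi_pmf_component)
    then have "distr (map_pmf real q) borel (\<lambda>x. x) = distr (distr ?Pi (count_space UNIV) (\<lambda>f. f i)) borel (\<lambda>x. x)"
      by (simp only: map_pmf_rep_eq[symmetric])
    also have "\<dots> = distr ?Pi borel (?X i)"
      by (subst distr_distr) (auto simp: comp_def)
    finally show ?thesis ..
  qed
  have "?Pi = map_pmf (\<lambda>h. real \<circ> h) (Pi_pmf {1..m} 0 (\<lambda>_. q))"
    by (rule Pi_pmf_map) auto
  then have "map_pmf (\<lambda>\<omega>. \<Sum>i=1..m. ?X i \<omega>) ?Pi = map_pmf real (map_pmf (\<lambda>\<omega>. \<Sum>i=1..m. \<omega> i) (Pi_pmf {1..m} 0 (\<lambda>_. q)))"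
    by (simp add: map_pmf_comp)
  also have "map_pmf (\<lambda>\<omega>. \<Sum>i=1..m. \<omega> i) (Pi_pmf {1..m} 0 (\<lambda>_. q)) = P"
    by (rule pmf_eqI) (simp add: pmf_sum_Pi_pmf q)
  finally have S: "map_pmf (\<lambda>\<omega>. \<Sum>i=1..m. ?X i \<omega>) ?Pi = map_pmf real P" .
  have "distr ?Pi borel (\<lambda>\<omega>. \<Sum>i=1..m. ?X i \<omega>) =
      distr (distr ?Pi (count_space UNIV) (\<lambda>\<omega>. \<Sum>i=1..m. ?X i \<omega>)) borel (\<lambda>x. x)"
    by (subst distr_distr) (auto simp: comp_def)
  also have "\<dots> = distr (distr P (count_space UNIV) real) borel (\<lambda>x. x)"
    by (simp only: map_pmf_rep_eq[symmetric] S)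
  also have "\<dots> = distr P borel real"
    by (subst distr_distr) (auto simp: comp_def)
  finally have D: "distr ?Pi borel (\<lambda>\<omega>. \<Sum>i=1..m. ?X i \<omega>) = distr P borel real" .
  have E: "\<forall>i\<in>{1..m}. \<forall>j\<in>{1..m}. distr ?Pi borel (?X i) = distr ?Pi borel (?X j)"
    using X by simp
  show "\<exists>(M :: (nat \<Rightarrow> real) measure) X. prob_space M \<and> prob_space.indep_vars M (\<lambda>_. borel) X {1..m} \<and>
        (\<forall>i\<in>{1..m}. \<forall>j\<in>{1..m}. distr M borel (X i) = distr M borel (X j)) \<and>
        distr M borel (\<lambda>\<omega>. \<Sum>i=1..m. X i \<omega>) = distr (measure_pmf P) borel real"
    by (rule exI[of _ "measure_pmf ?Pi"], rule exI[of _ ?X], intro conjI)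
      (rule measure_pmf.prob_space_axioms indep E D)+
qed

text \<open>
  By the recurrence, the generating function of \<open>P\<close> is \<open>P(0) exp B(x)\<close> with \<open>B(x) = \<Sum>k. A\<^sub>k x\<^sup>k / k\<close>. As \<open>B\<close> has
  nonnegative coefficients, so has the root \<open>exp (B(x) / m)\<close>, and its coefficients are dominated by those of \<open>exp B(x)\<close>.
  Hence it is summable and can be normalized to a distribution.
\<close>
lemma infinitely_divisible_katti:
  fixes P :: "nat pmf" and A :: "nat \<Rightarrow> real"
  assumes A: "\<And>k. 0 \<le> A k" "A 0 = 0"
    and rec: "\<And>n. real n * pmf P n = (\<Sum>k\<le>n. A k * pmf P (n - k))"
  shows "infinitely_divisible (distr (measure_pmf P) borel real)"
proof (rule infinitely_divisible_pmfI)
  fix m :: nat assume m: "1 \<le> m"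
  define B where "B = Abs_fps (\<lambda>n. A n / n)"
  define g where "g = fps_exp (1 / m) oo B"
  have Bnn: "0 \<le> B $ n" for n using A by (simp add: B_def)
  have H0: "(fps_exp s oo B) $ 0 = 1" for s by simp
  have rec': "real k * (fps_exp 1 oo B) $ k = (\<Sum>i\<le>k. A i * (fps_exp 1 oo B) $ (k - i))" for k
    using fps_exp_compose_recurrence[where A=A and s=1 and n=k, OF A(2)]
    unfolding B_def mult_1 .
  have P: "pmf P n = pmf P 0 * (fps_exp 1 oo B) $ n" for n
    by (rule recurrence_unique[where A=A and f="pmf P" and g="\<lambda>n. (fps_exp 1 oo B) $ n", OF A(2) rec rec' H0])
  have P0: "0 < pmf P 0"
  proof (rule ccontr)
    assume "\<not> 0 < pmf P 0"
    then have "pmf P 0 = 0" using pmf_nonneg[of P 0] by linarith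
    then have "pmf P n = 0" for n using P[of n] by simp
    then have "pmf P = (\<lambda>_. 0)" by auto
    then show False using sums_unique[OF sums_pmf_nat[of P]] by simp
  qed
  have gnn: "0 \<le> g $ n" for n unfolding g_def using Bnn by (intro fps_exp_compose_nonneg) auto
  have H1: "(fps_exp 1 oo B) $ n = pmf P n / pmf P 0" for n
  proof -
    have "(fps_exp 1 oo B) $ n * pmf P 0 = pmf P n" using P[of n] by (simp only: mult.commute)
    then show ?thesis using P0 by (intro eq_divide_imp) auto
  qed
  have gle: "g $ n \<le> pmf P n / pmf P 0" for n
    unfolding g_def H1[symmetric] using m by (intro fps_exp_compose_mono Bnn) auto
  have sg: "summable (\<lambda>n. g $ n)"
  proof (rule summable_comparison_test')
    show "summable (\<lambda>n. pmf P n / pmf P 0)"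
      by (intro summable_divide sums_summable[OF sums_pmf_nat])
    show "norm (g $ n) \<le> pmf P n / pmf P 0" for n
      unfolding real_norm_def abs_of_nonneg[OF gnn] by (rule gle)
  qed
  define Z where "Z = (\<Sum>n. g $ n)"
  have "g $ 0 \<le> Z" unfolding Z_def using sg gnn sum_le_suminf[of "\<lambda>n. g $ n" "{0}"] by auto
  then have Z: "0 < Z" by (simp add: g_def)
  have "(\<lambda>n. g $ n / Z) sums 1"
    using sums_divide[OF summable_sums[OF sg], of Z] Z by (simp add: Z_def)
  then obtain q :: "nat pmf" where q: "\<And>n. pmf q n = g $ n / Z"
    using pmf_nat_of_sums[of "\<lambda>n. g $ n / Z"] gnn Z by auto
  have "Abs_fps (pmf q) = fps_const (1 / Z) * g" by (rule fps_ext) (simp add: q)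
  then have "Abs_fps (pmf q) ^ m = fps_const (1 / Z ^ m) * (g ^ m)"
    by (simp add: power_mult_distrib power_divide fps_const_power)
  also have "g ^ m = fps_exp 1 oo B"
    unfolding g_def using m by (subst fps_compose_power) (auto simp: fps_exp_power_mult B_def A)
  finally have qm: "(Abs_fps (pmf q) ^ m) $ n = pmf P n / (Z ^ m * pmf P 0)" for n
    by (simp add: H1)
  \<comment> \<open>the powers of q and the values of P are proportional; both have total mass one, so the factor is one\<close>
  let ?S = "map_pmf (\<lambda>\<omega>. \<Sum>i\<in>{1..m}. \<omega> i) (Pi_pmf {1..m} 0 (\<lambda>_. q))"
  have S: "pmf ?S n = (Abs_fps (pmf q) ^ m) $ n" for n
    using pmf_sum_Pi_pmf[of "{1..m}" q n] by simp
  have "(\<lambda>n. pmf P n / (Z ^ m * pmf P 0)) sums 1"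
    using sums_pmf_nat[of ?S] unfolding S qm by simp
  moreover have "(\<lambda>n. pmf P n / (Z ^ m * pmf P 0)) sums (1 / (Z ^ m * pmf P 0))"
    by (intro sums_divide sums_pmf_nat)
  ultimately have "1 / (Z ^ m * pmf P 0) = 1" by (rule sums_unique2[symmetric])
  then have "Z ^ m * pmf P 0 = 1" by simp
  then show "\<exists>q :: nat pmf. \<forall>n. pmf P n = (Abs_fps (pmf q) ^ m) $ n"
    using qm by (intro exI[of _ q]) simp
qed

section \<open>The distribution of the size of a random forest\<close>

text \<open>
  The numbers of trees are integers, so those that do not vanish are at least one, and \<open>n powr (5 / 2)\<close> alone is unbounded.
\<close>
lemma otter_radius_less_1:
  fixes \<alpha> \<beta> :: real
  assumes "0 < \<alpha>" "0 < \<beta>"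
    and lim: "(\<lambda>n. \<alpha> ^ n * real n powr (5 / 2) * real (num_trees n)) \<longlonglongrightarrow> \<beta>"
  shows "\<alpha> < 1"
proof (rule ccontr)
  assume "\<not> \<alpha> < 1"
  let ?g = "\<lambda>n. \<alpha> ^ n * real n powr (5 / 2) * real (num_trees n)"
  have "\<forall>\<^sub>F n in sequentially. 0 < ?g n" using order_tendstoD(1)[OF lim assms(2)] .
  moreover have "\<forall>\<^sub>F n in sequentially. ?g n < \<beta> + 1" using order_tendstoD(2)[OF lim, of "\<beta> + 1"] by simp
  moreover have "\<forall>\<^sub>F n in sequentially. \<beta> + 1 < real n"
    using filterlim_real_sequentially by (auto simp: filterlim_at_top_dense)
  ultimately have "\<forall>\<^sub>F n in sequentially. False"
  proof eventually_elim
    case (elim n)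
    have "num_trees n \<noteq> 0" using elim(1) by (intro notI) simp
    then have t: "1 \<le> real (num_trees n)" by simp
    have n: "1 \<le> real n" using elim(3) assms(2) by simp
    have "real n = real n powr 1" using n by simp
    also have "\<dots> \<le> real n powr (5 / 2)" using n by (intro powr_mono) auto
    also have "\<dots> \<le> \<alpha> ^ n * real n powr (5 / 2)"
      using one_le_power[of \<alpha> n] \<open>\<not> \<alpha> < 1\<close> by (intro mult_le_cancel_right1[THEN iffD2]) auto
    also have "\<dots> \<le> ?g n" using mult_left_mono[OF t, of "\<alpha> ^ n * real n powr (5 / 2)"] assms(1) by simp
    finally show False using elim by simp
  qed
  then show False by simp
qed

text \<open>
  The factor \<open>n\<close> in \<open>r\<^sub>n \<le> n t\<^sub>n\<close> weakens the exponent \<open>5 / 2\<close> to \<open>3 / 2\<close>, which is still greater than one.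
\<close>
lemma summable_rooted_trees_at_radius:
  fixes \<alpha> \<beta> :: real
  assumes "0 < \<alpha>"
    and lim: "(\<lambda>n. \<alpha> ^ n * real n powr (5 / 2) * real (num_trees n)) \<longlonglongrightarrow> \<beta>"
  shows "summable (\<lambda>k. real (num_rooted_trees k) * \<alpha> ^ k)"
proof -
  let ?g = "\<lambda>n. \<alpha> ^ n * real n powr (5 / 2) * real (num_trees n)"
  obtain K where K: "\<And>n. norm (?g n) \<le> K"
    using convergent_imp_Bseq[of ?g] lim by (auto simp: convergent_def Bseq_def)
  show ?thesis
  proof (rule summable_comparison_test')
    have "summable (\<lambda>n. real n powr (- 3 / 2))" by (subst summable_real_powr_iff) simp
    then show "summable (\<lambda>n. K * real n powr (- 3 / 2))" by (rule summable_mult)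
    fix n
    show "norm (real (num_rooted_trees n) * \<alpha> ^ n) \<le> K * real n powr (- 3 / 2)"
    proof (cases "n = 0")
      case True
      then show ?thesis using num_rooted_trees_le[of 0] by simp
    next
      case False
      have "real (num_rooted_trees n) \<le> real n * real (num_trees n)"
        using num_rooted_trees_le[of n] by (metis of_nat_le_iff of_nat_mult)
      then have "real (num_rooted_trees n) * \<alpha> ^ n \<le> real n * real (num_trees n) * \<alpha> ^ n"
        using assms(1) by (intro mult_right_mono) auto
      also have "real n = real n powr (5 / 2) * real n powr (- 3 / 2)"
        using False by (simp add: powr_add[symmetric])
      also have "\<dots> * real (num_trees n) * \<alpha> ^ n = ?g n * real n powr (- 3 / 2)" by simp
      also have "\<dots> \<le> K * real n powr (- 3 / 2)"
        using K[of n] by (intro mult_right_mono) auto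
      finally show ?thesis using assms(1) by simp
    qed
  qed
qed

lemma not_summable_beyond_radius:
  fixes \<alpha> \<beta> :: real
  assumes "0 < \<alpha>" "0 < \<beta>"
    and lim: "(\<lambda>n. \<alpha> ^ n * real n powr (5 / 2) * real (num_trees n)) \<longlonglongrightarrow> \<beta>"
    and x: "\<alpha> < x"
  shows "\<not> summable (\<lambda>k. real (num_rooted_trees k) * x ^ k)"
proof
  let ?g = "\<lambda>n. \<alpha> ^ n * real n powr (5 / 2) * real (num_trees n)"
  assume "summable (\<lambda>k. real (num_rooted_trees k) * x ^ k)"
  then have r: "(\<lambda>k. real (num_rooted_trees k) * x ^ k) \<longlonglongrightarrow> 0" by (rule summable_LIMSEQ_zero)
  define q where "q = \<alpha> / x"
  have q: "0 < q" "q < 1" using assms by (auto simp: q_def)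
  have "(\<lambda>n. real n powr (5 / 2) * q ^ n) \<longlonglongrightarrow> 0" using q by real_asymp
  from tendsto_mult[OF this r] have "(\<lambda>n. real n powr (5 / 2) * q ^ n * (real (num_rooted_trees n) * x ^ n)) \<longlonglongrightarrow> 0"
    by simp
  moreover have "?g n \<le> real n powr (5 / 2) * q ^ n * (real (num_rooted_trees n) * x ^ n)" for n
  proof -
    have "?g n = real n powr (5 / 2) * q ^ n * (real (num_trees n) * x ^ n)"
      using assms by (simp add: q_def power_divide)
    also have "\<dots> \<le> real n powr (5 / 2) * q ^ n * (real (num_rooted_trees n) * x ^ n)"
      using num_trees_le_num_rooted_trees[of n] q assms by (intro mult_left_mono mult_right_mono) auto
    finally show ?thesis .
  qed
  ultimately have "\<beta> \<le> 0" using LIMSEQ_le[OF lim] by blast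
  then show False using assms(2) by simp
qed

theorem theorem3:
  fixes \<alpha> \<beta> \<rho> :: real
  assumes "0 < \<alpha>" and "0 < \<beta>"
    and "(\<lambda>n. \<alpha> ^ n * real n powr (5 / 2) * real (num_trees n)) \<longlonglongrightarrow> \<beta>"
    and "\<rho> = (\<Prod>k. (1 - \<alpha> ^ Suc k) ^ num_trees (Suc k))"
  shows "convergent_prod (\<lambda>k. (1 - \<alpha> ^ Suc k) ^ num_trees (Suc k)) \<and>
    (\<forall>n. convergent_prod (\<lambda>k. (1 - \<alpha> ^ Suc k) ^ (num_trees (Suc k) + n * num_rooted_trees (Suc k)))) \<and>
    (\<forall>n. \<rho> * \<alpha> ^ n * real (num_forests n) =
         real (num_forests n) *
           (\<Prod>k. (1 - \<alpha> ^ Suc k) ^ (num_trees (Suc k) + n * num_rooted_trees (Suc k)))) \<and>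
    (\<exists>P :: nat pmf. (\<forall>n. pmf P n = \<rho> * \<alpha> ^ n * real (num_forests n)) \<and>
         infinitely_divisible (distr (measure_pmf P) borel real))"
proof -
  have \<alpha>: "0 < \<alpha>" "\<alpha> < 1" "0 \<le> \<alpha>" using assms(1) otter_radius_less_1[OF assms(1-3)] by auto
  let ?lt = "\<lambda>k. real (num_trees k) * log_geom (\<alpha> ^ k)"
  let ?lr = "\<lambda>k. real (num_rooted_trees k) * log_geom (\<alpha> ^ k)"
  have zero: "num_trees 0 = 0" "num_rooted_trees 0 = 0"
    using num_trees_le_num_rooted_trees[of 0] num_rooted_trees_le[of 0] by auto
  have sr: "summable (\<lambda>k. real (num_rooted_trees k) * \<alpha> ^ k)"
    by (rule summable_rooted_trees_at_radius[OF assms(1,3)])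
  have st: "summable (\<lambda>k. real (num_trees k) * \<alpha> ^ k)"
    using num_trees_le_num_rooted_trees \<alpha>
    by (intro summable_comparison_test'[OF sr]) (auto intro!: mult_right_mono)
  have slr: "summable ?lr" by (rule summable_log_geom[OF zero(2) \<alpha>(3,2) sr])
  have slt: "summable ?lt" by (rule summable_log_geom[OF zero(1) \<alpha>(3,2) st])
  have "(\<Sum>k. real (num_rooted_trees k) * \<alpha> ^ k) = 1"
    using rooted_trees.sum_at_radius_eq_1[OF \<alpha>(1,2)] sr not_summable_beyond_radius[OF assms(1-3)]
    unfolding num_rooted_trees_eq by blast
  \<comment> \<open>insert \<open>T(\<alpha>) = 1\<close> into the functional equation\<close>
  then have "\<alpha> * exp (suminf ?lr) = 1"
    using rooted_trees.functional_equation[OF \<alpha>(3,2)] sr unfolding num_rooted_trees_eq by simp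
  then have \<alpha>_eq: "exp (- suminf ?lr) = \<alpha>" by (simp add: exp_minus field_simps)
  have prod_t: "(\<lambda>k. (1 - \<alpha> ^ Suc k) ^ num_trees (Suc k)) has_prod exp (- suminf ?lt)"
    by (rule euler_product[OF zero(1) \<alpha>(3,2) slt])
  then have \<rho>: "\<rho> = exp (- suminf ?lt)" unfolding assms(4) by (rule has_prod_unique[symmetric])
  have prod_n: "(\<lambda>k. (1 - \<alpha> ^ Suc k) ^ (num_trees (Suc k) + n * num_rooted_trees (Suc k))) has_prod (\<rho> * \<alpha> ^ n)" for n
  proof -
    let ?a = "\<lambda>k. num_trees k + n * num_rooted_trees k"
    have eq: "real (?a k) * log_geom (\<alpha> ^ k) = ?lt k + real n * ?lr k" for k by (simp add: algebra_simps)
    have "(\<lambda>k. real (?a k) * log_geom (\<alpha> ^ k)) sums (suminf ?lt + real n * suminf ?lr)"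
      unfolding eq using slt slr by (intro sums_add sums_mult summable_sums)
    then have s: "summable (\<lambda>k. real (?a k) * log_geom (\<alpha> ^ k))"
        "(\<Sum>k. real (?a k) * log_geom (\<alpha> ^ k)) = suminf ?lt + real n * suminf ?lr"
      by (simp_all only: sums_iff)
    have "exp (- (suminf ?lt + real n * suminf ?lr)) = exp (- suminf ?lt) * exp (real n * (- suminf ?lr))"
      by (simp add: exp_add[symmetric])
    also have "\<dots> = \<rho> * \<alpha> ^ n" unfolding exp_of_nat_mult \<alpha>_eq \<rho> ..
    finally show ?thesis
      using euler_product[of ?a, OF _ \<alpha>(3,2) s(1)] zero unfolding s(2) by simp
  qed
  have "(\<lambda>n. real (num_forests n) * \<alpha> ^ n) sums exp (suminf ?lt)"
    using trees.num_msets_sums[OF \<alpha>(3,2)] slt unfolding num_forests_eq num_trees_eq by blast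
  then have "(\<lambda>n. \<rho> * (real (num_forests n) * \<alpha> ^ n)) sums (\<rho> * exp (suminf ?lt))" by (rule sums_mult)
  also have "\<rho> * exp (suminf ?lt) = 1" unfolding \<rho> by (simp add: exp_minus)
  finally have total: "(\<lambda>n. \<rho> * \<alpha> ^ n * real (num_forests n)) sums 1" by (simp add: mult_ac)
  have "0 \<le> \<rho> * \<alpha> ^ n * real (num_forests n)" for n unfolding \<rho> using \<alpha> by simp
  then obtain P :: "nat pmf" where P: "\<And>n. pmf P n = \<rho> * \<alpha> ^ n * real (num_forests n)"
    using pmf_nat_of_sums[OF _ total] by blast
  \<comment> \<open>the coefficients of \<open>x\<close> times the derivative of \<open>log F(\<alpha>x)\<close>\<close>
  define A where "A k = real (divisor_weight trees.classes fst k) * \<alpha> ^ k" for k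
  have "infinitely_divisible (distr (measure_pmf P) borel real)"
  proof (rule infinitely_divisible_katti[where A = A])
    show "0 \<le> A k" for k using \<alpha> by (simp add: A_def)
    show "A 0 = 0" by (simp add: A_def divisor_weight_def)
    fix n
    have "real n * pmf P n = \<rho> * \<alpha> ^ n * (real n * real (trees.num_msets n))"
      by (simp add: P num_forests_eq)
    also have "\<dots> = (\<Sum>k\<le>n. \<rho> * \<alpha> ^ n * (real (divisor_weight trees.classes fst k) * real (trees.num_msets (n - k))))"
      unfolding trees.num_msets_recurrence by (simp add: sum_distrib_left)
    also have "\<dots> = (\<Sum>k\<le>n. A k * pmf P (n - k))"
    proof (rule sum.cong)
      fix k assume "k \<in> {..n}"
      then have "\<alpha> ^ n = \<alpha> ^ k * \<alpha> ^ (n - k)" by (simp add: power_add[symmetric])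
      then show "\<rho> * \<alpha> ^ n * (real (divisor_weight trees.classes fst k) * real (trees.num_msets (n - k))) =
          A k * pmf P (n - k)"
        by (simp add: A_def P num_forests_eq)
    qed simp
    finally show "real n * pmf P n = (\<Sum>k\<le>n. A k * pmf P (n - k))" .
  qed
  moreover have "\<rho> * \<alpha> ^ n * real (num_forests n) = real (num_forests n) *
      (\<Prod>k. (1 - \<alpha> ^ Suc k) ^ (num_trees (Suc k) + n * num_rooted_trees (Suc k)))" for n
    unfolding has_prod_unique[OF prod_n, symmetric] by (rule mult.commute)
  ultimately show ?thesis
    using has_prod_iff[THEN iffD1, OF prod_t] has_prod_iff[THEN iffD1, OF prod_n] P by blast
qed

end
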